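(* Let $(G,p)$ be a discrete periodic framework in $\mathbb{R}^d$ with spatial symmetry group $\mathcal{G}$, and let $\mathcal{T}\subseteq\mathcal{G}$ be a full rank translation subgroup isomorphic to $\mathbb{Z}^d$ (normal in $\mathcal{G}$). Then $$\Gamma_p(m)-\Gamma_p(s)=\Gamma_p(v)\cdot\Gamma(sp)-\Gamma_p(e)-\Gamma_p(rig),$$ where $\Gamma_p(m)$ (resp. $\Gamma_p(s)$) is the character list of the representation of the finite group $\mathcal{G}/\mathcal{T}$ on the space of periodic (proper infinitesimal) mechanisms (resp. the space of periodic stresses). Here $\cdot$ is the entrywise product, and the equation is an equality of traces at each element $h\in\mathcal{G}/\mathcal{T}$.
   Context: $G=(V,E)$ is a countably infinite connected simple graph with all vertices of finite degree, and $p=(p_v)_{v\in V}$ is a family of distinct points of $\mathbb{R}^d$. The spatial symmetry group $\mathcal{G}$ is the group of $g=(\sigma,T)$ where $\sigma$ is an automorphism of $G$ and $T$ an isometry of $\mathbb{R}^d$ with $p_{\sigma(v)}=Tp_v$ for all $v$. The framework is discrete periodic with respect to $\mathcal{T}$: $\mathcal{T}\subseteq\mathcal{G}$ is a subgroup of elements effected by translations, generated by $d$ translations with linearly independent translation vectors (so $\mathcal{T}\cong\mathbb{Z}^d$), and there are finitely many $\mathcal{T}$-orbits of framework points. $\mathcal{T}$ need not be the full translation subgroup of $\mathcal{G}$. On $\mathcal{H}_v=\prod_V\mathbb{R}^d$ and $\mathcal{H}_e=\prod_E\mathbb{R}$, for $g=(\sigma,T)\in\mathcal{G}$ with linear part $S=\rho_{sp}(g)\in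 O(d)$ of $T$, put $(\hat\rho_v(g)u)_{\sigma(v)}=Su_v$ and $(\rho_e(g)w)_{\sigma(f)}=w_f$. The rigidity matrix is the linear map $R(G,p):\mathcal{H}_v\to\mathcal{H}_e$ with $(R(G,p)u)_e=\langle p_v-p_w,u_v-u_w\rangle$ for $e=(v,w)\in E$. $\mathcal{H}_v^{p}\subseteq\mathcal{H}_v$ and $\mathcal{H}_e^{p}\subseteq\mathcal{H}_e$ are the finite-dimensional subspaces of $\mathcal{T}$-periodic vectors (families constant on $\mathcal{T}$-orbits), with the Euclidean inner products obtained by summing over one representative of each $\mathcal{T}$-orbit. $R(G,p)$ restricts to a linear map $R^{(p)}:\mathcal{H}_v^{p}\to\mathcal{H}_e^{p}$. The representations $\hat\rho_v,\rho_e$ induce representations $\hat\pi_v,\pi_e$ of $\mathcal{G}/\mathcal{T}$ on $\mathcal{H}_v^{p},\mathcal{H}_e^{p}$, with $\hat\pi_v=\pi_n\otimes\rho_{sp}$, where $\pi_n$ is the permutation representation of $\mathcal{G}/\mathcal{T}$ on the real vector space with basis the $\mathcal{T}$-orbits of vertices, and $\rho_{sp}$ (trivial on $\mathcal{T}$) is regarded as a representation of $\mathcal{G}/\mathcal{T}$. $\mathcal{H}^{p}_{rig}$ is the $d$-dimensional space of translation flexes (constant families) in $\mathcal{H}^p_v$; $\mathcal{H}^{p}_{m}$, the space of periodic mechanisms, is the orthogonal complement of $\mathcal{H}^p_{rig}$ in $\ker R^{(p)}$; the space of periodic stresses $\mathcal{H}^p_{str}$ is $\operatorname{coker}R^{(p)}$,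 the orthogonal complement of the range of $R^{(p)}$ in $\mathcal{H}_e^{p}$. These are invariant subspaces. $\Gamma_p(v),\Gamma(sp),\Gamma_p(e)$ are the character lists (traces at elements of $\mathcal{G}/\mathcal{T}$) of $\pi_n,\rho_{sp},\pi_e$; $\Gamma_p(m),\Gamma_p(rig)$ are those of the restrictions of $\hat\pi_v$ to $\mathcal{H}^p_m,\mathcal{H}^p_{rig}$; and $\Gamma_p(s)$ is that of the restriction of $\pi_e$ to $\mathcal{H}^p_{str}$. *)

theory Defs
  imports
    "HOL-Analysis.Analysis"
    "HOL-Library.Function_Algebras"
    "HOL-Algebra.Group_Action"
    "HOL-Algebra.Generated_Groups"
begin

text \<open>
  Pointwise scalar multiplication. Together with \<open>Function_Algebras\<close> it makes
  \<open>\<Prod>\<^sub>V \<real>\<^sup>d = ('v \<Rightarrow> real ^ 'd)\<close> a real vector space.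
\<close>

instantiation "fun" :: (type, real_vector) real_vector
begin

definition scaleR_fun :: "real \<Rightarrow> ('a \<Rightarrow> 'b) \<Rightarrow> 'a \<Rightarrow> 'b"
  where "scaleR_fun c f = (\<lambda>x. c *\<^sub>R f x)"

instance
  by standard (simp_all add: scaleR_fun_def fun_eq_iff scaleR_add_right scaleR_add_left)

end

text \<open>
  The trace of the restriction of \<open>A\<close> to a finite-dimensional \<open>A\<close>-invariant subspace \<open>U\<close>: the sum
  of the diagonal coefficients of \<open>A\<close> with respect to a basis of \<open>U\<close>.
\<close>

definition trace_on :: "'a::real_vector set \<Rightarrow> ('a \<Rightarrow> 'a) \<Rightarrow> real"
  where "trace_on U A =
    (let B = (SOME B. independent B \<and> span B = U) in \<Sum>b\<in>B. representation B (A b) b)"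

text \<open>
  The vertices are the elements of the type \<open>'v\<close>, the edges are two-element sets of vertices, and
  the dimension \<open>d\<close> is \<open>CARD('d)\<close>.
\<close>

definition bar_joint_framework :: "'v set set \<Rightarrow> ('v \<Rightarrow> real ^ 'd) \<Rightarrow> bool"
  where "bar_joint_framework E p \<longleftrightarrow>
    infinite (UNIV :: 'v set) \<and> countable (UNIV :: 'v set) \<and>
    (\<forall>e\<in>E. card e = 2) \<and>
    (\<forall>v w. (v, w) \<in> {(x, y). {x, y} \<in> E}\<^sup>*) \<and>
    (\<forall>v. finite {e \<in> E. v \<in> e}) \<and>
    inj p"

definition graph_automorphism :: "'v set set \<Rightarrow> ('v \<Rightarrow> 'v) \<Rightarrow> bool"
  where "graph_automorphism E \<sigma> \<longleftrightarrow> bij \<sigma> \<and> (\<forall>v w. {\<sigma> v, \<sigma> w} \<in> E \<longleftrightarrow> {v, w} \<in> E)"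

type_synonym ('v, 'd) sym = "('v \<Rightarrow> 'v) \<times> (real ^ 'd \<Rightarrow> real ^ 'd)"

definition sym_group :: "'v set set \<Rightarrow> ('v \<Rightarrow> real ^ 'd) \<Rightarrow> ('v, 'd) sym monoid"
  where "sym_group E p =
    \<lparr> carrier = {(\<sigma>, T). graph_automorphism E \<sigma> \<and> (\<forall>x y. dist (T x) (T y) = dist x y) \<and>
                         (\<forall>v. p (\<sigma> v) = T (p v))},
      mult = (\<lambda>(\<sigma>, T) (\<sigma>', T'). (\<sigma> \<circ> \<sigma>', T \<circ> T')),
      one = (id, id) \<rparr>"

definition full_rank_translation_subgroup ::
    "'v set set \<Rightarrow> ('v \<Rightarrow> real ^ 'd) \<Rightarrow> ('v, 'd) sym set \<Rightarrow> bool"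
  where "full_rank_translation_subgroup E p \<T> \<longleftrightarrow>
    (\<exists>(g :: 'd \<Rightarrow> ('v, 'd) sym) t.
       (\<forall>i. g i \<in> carrier (sym_group E p) \<and> snd (g i) = (\<lambda>x. x + t i)) \<and>
       inj t \<and> independent (range t) \<and>
       \<T> = generate (sym_group E p) (range g))"

definition vertex_orbits ::
    "'v set set \<Rightarrow> ('v \<Rightarrow> real ^ 'd) \<Rightarrow> ('v, 'd) sym set \<Rightarrow> 'v set set"
  where "vertex_orbits E p \<T> = orbits (sym_group E p\<lparr>carrier := \<T>\<rparr>) UNIV (\<lambda>g. fst g)"

definition edge_orbits ::
    "'v set set \<Rightarrow> ('v \<Rightarrow> real ^ 'd) \<Rightarrow> ('v, 'd) sym set \<Rightarrow> 'v set set set"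
  where "edge_orbits E p \<T> =
    orbits (sym_group E p\<lparr>carrier := \<T>\<rparr>) E (\<lambda>g. \<lambda>e\<in>E. fst g ` e)"

text \<open>Since \<open>p\<close> is injective, orbits of framework points and orbits of vertices agree.\<close>

definition discrete_periodic_framework ::
    "'v set set \<Rightarrow> ('v \<Rightarrow> real ^ 'd) \<Rightarrow> ('v, 'd) sym set \<Rightarrow> bool"
  where "discrete_periodic_framework E p \<T> \<longleftrightarrow>
    bar_joint_framework E p \<and> full_rank_translation_subgroup E p \<T> \<and>
    finite (vertex_orbits E p \<T>)"

definition rho_sp :: "('v, 'd) sym \<Rightarrow> real ^ 'd \<Rightarrow> real ^ 'd"
  where "rho_sp g = (\<lambda>x. snd g x - snd g 0)"

text \<open>
  Solved for the value at the argument, \<open>(\<rho>\<^sub>v(g) u)\<^bsub>\<sigma>(v)\<^esub> = S u\<^sub>v\<close> and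
  \<open>(\<rho>\<^sub>e(g) w)\<^bsub>\<sigma>(f)\<^esub> = w\<^sub>f\<close> read as follows; for a bijection the preimage of a set is its image
  under the inverse.
\<close>

definition rho_v :: "('v, 'd) sym \<Rightarrow> ('v \<Rightarrow> real ^ 'd) \<Rightarrow> 'v \<Rightarrow> real ^ 'd"
  where "rho_v g u = (\<lambda>v. rho_sp g (u (inv_into UNIV (fst g) v)))"

definition rho_e :: "('v, 'd) sym \<Rightarrow> ('v set \<Rightarrow> real) \<Rightarrow> 'v set \<Rightarrow> real"
  where "rho_e g w = (\<lambda>e. w (fst g -` e))"

text \<open>
  The permutation action on vertex orbits: the basis vector of the orbit \<open>Q\<close> goes to that of
  \<open>\<sigma>(Q)\<close>.
\<close>

definition rho_n :: "('v, 'd) sym \<Rightarrow> ('v set \<Rightarrow> real) \<Rightarrow> 'v set \<Rightarrow> real"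
  where "rho_n g f = (\<lambda>Q. f (fst g -` Q))"

definition vertex_orbit_space ::
    "'v set set \<Rightarrow> ('v \<Rightarrow> real ^ 'd) \<Rightarrow> ('v, 'd) sym set \<Rightarrow> ('v set \<Rightarrow> real) set"
  where "vertex_orbit_space E p \<T> = {f. \<forall>Q. Q \<notin> vertex_orbits E p \<T> \<longrightarrow> f Q = 0}"

text \<open>
  The representation of the quotient group on \<open>U\<close> induced by \<open>\<rho>\<close>: when all members of the coset
  \<open>h\<close> act on \<open>U\<close> by the same map, as in all uses below, this map is the value at \<open>h\<close>.
\<close>

definition quotient_rep :: "('g \<Rightarrow> 'a \<Rightarrow> 'a) \<Rightarrow> 'a set \<Rightarrow> 'g set \<Rightarrow> 'a \<Rightarrow> 'a"
  where "quotient_rep \<rho> U h = the_elem ((\<lambda>g. restrict (\<rho> g) U) ` h)"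

definition Hv :: "('v, 'd) sym set \<Rightarrow> ('v \<Rightarrow> real ^ 'd) set"
  where "Hv \<T> = {u. \<forall>g\<in>\<T>. \<forall>v. u (fst g v) = u v}"

text \<open>A vector indexed by the edges is a function on all vertex sets that vanishes outside \<open>E\<close>.\<close>

definition He :: "'v set set \<Rightarrow> ('v, 'd) sym set \<Rightarrow> ('v set \<Rightarrow> real) set"
  where "He E \<T> = {w. (\<forall>e. e \<notin> E \<longrightarrow> w e = 0) \<and> (\<forall>g\<in>\<T>. \<forall>e\<in>E. w (fst g ` e) = w e)}"

definition inner_v ::
    "'v set set \<Rightarrow> ('v \<Rightarrow> real ^ 'd) \<Rightarrow> ('v, 'd) sym set \<Rightarrow>
     ('v \<Rightarrow> real ^ 'd) \<Rightarrow> ('v \<Rightarrow> real ^ 'd) \<Rightarrow> real"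
  where "inner_v E p \<T> u u' =
    (\<Sum>Q\<in>vertex_orbits E p \<T>. u (SOME v. v \<in> Q) \<bullet> u' (SOME v. v \<in> Q))"

definition inner_e ::
    "'v set set \<Rightarrow> ('v \<Rightarrow> real ^ 'd) \<Rightarrow> ('v, 'd) sym set \<Rightarrow>
     ('v set \<Rightarrow> real) \<Rightarrow> ('v set \<Rightarrow> real) \<Rightarrow> real"
  where "inner_e E p \<T> w w' =
    (\<Sum>Q\<in>edge_orbits E p \<T>. w (SOME e. e \<in> Q) * w' (SOME e. e \<in> Q))"

text \<open>The expression below is symmetric in \<open>v\<close> and \<open>w\<close>, so it depends on the edge only.\<close>

definition rigidity_map ::
    "'v set set \<Rightarrow> ('v \<Rightarrow> real ^ 'd) \<Rightarrow> ('v \<Rightarrow> real ^ 'd) \<Rightarrow> 'v set \<Rightarrow> real"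
  where "rigidity_map E p u = (\<lambda>e.
    if e \<in> E then THE r. \<exists>v w. e = {v, w} \<and> r = (p v - p w) \<bullet> (u v - u w) else 0)"

definition H_rig :: "('v \<Rightarrow> real ^ 'd) set"
  where "H_rig = range (\<lambda>c. \<lambda>v. c)"

definition H_mech ::
    "'v set set \<Rightarrow> ('v \<Rightarrow> real ^ 'd) \<Rightarrow> ('v, 'd) sym set \<Rightarrow> ('v \<Rightarrow> real ^ 'd) set"
  where "H_mech E p \<T> =
    {u \<in> Hv \<T>. rigidity_map E p u = 0 \<and> (\<forall>r\<in>H_rig. inner_v E p \<T> u r = 0)}"

definition H_str ::
    "'v set set \<Rightarrow> ('v \<Rightarrow> real ^ 'd) \<Rightarrow> ('v, 'd) sym set \<Rightarrow> ('v set \<Rightarrow> real) set"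
  where "H_str E p \<T> =
    {w \<in> He E \<T>. \<forall>u\<in>Hv \<T>. inner_e E p \<T> w (rigidity_map E p u) = 0}"

definition Gamma_v ::
    "'v set set \<Rightarrow> ('v \<Rightarrow> real ^ 'd) \<Rightarrow> ('v, 'd) sym set \<Rightarrow> ('v, 'd) sym set \<Rightarrow> real"
  where "Gamma_v E p \<T> h =
    trace_on (vertex_orbit_space E p \<T>) (quotient_rep rho_n (vertex_orbit_space E p \<T>) h)"

definition Gamma_sp :: "('v, 'd::finite) sym set \<Rightarrow> real"
  where "Gamma_sp h = trace_on UNIV (quotient_rep rho_sp UNIV h)"

definition Gamma_e ::
    "'v set set \<Rightarrow> ('v, 'd::finite) sym set \<Rightarrow> ('v, 'd) sym set \<Rightarrow> real"
  where "Gamma_e E \<T> h = trace_on (He E \<T>) (quotient_rep rho_e (He E \<T>) h)"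

definition Gamma_rig :: "('v, 'd::finite) sym set \<Rightarrow> ('v, 'd) sym set \<Rightarrow> real"
  where "Gamma_rig \<T> h = trace_on H_rig (quotient_rep rho_v (Hv \<T>) h)"

definition Gamma_m ::
    "'v set set \<Rightarrow> ('v \<Rightarrow> real ^ 'd) \<Rightarrow> ('v, 'd) sym set \<Rightarrow> ('v, 'd) sym set \<Rightarrow> real"
  where "Gamma_m E p \<T> h = trace_on (H_mech E p \<T>) (quotient_rep rho_v (Hv \<T>) h)"

definition Gamma_s ::
    "'v set set \<Rightarrow> ('v \<Rightarrow> real ^ 'd) \<Rightarrow> ('v, 'd) sym set \<Rightarrow> ('v, 'd) sym set \<Rightarrow> real"
  where "Gamma_s E p \<T> h = trace_on (H_str E p \<T>) (quotient_rep rho_e (He E \<T>) h)"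

end

theory Submission
  imports Defs
begin

text \<open>
  The formula is an Euler characteristic. Fix an element \<open>g\<close> of the coset \<open>h\<close>. It acts on the periodic
  velocity fields \<open>Hv\<close> and on the periodic edge vectors \<open>He\<close> by linear maps that preserve the inner
  products, and the rigidity map \<open>R\<close> intertwines the two actions: replacing \<open>p\<close> and \<open>u\<close> by their
  rotated copies does not change the inner products \<open>(p v - p w) \<bullet> (u v - u w)\<close>. Orthogonal
  complements of invariant subspaces are then invariant, so \<open>Hv\<close> splits into the translation flexes, the
  mechanisms and the complement of \<open>ker R\<close>, while \<open>He\<close> splits into the range of \<open>R\<close> and the stresses.
  Since \<open>R\<close> identifies the complement of \<open>ker R\<close> with the range of \<open>R\<close>, the traces of \<open>g\<close> on these two
  pieces cancel, and
  \<open>tr(mechanisms) - tr(stresses) = tr(Hv) - tr(He) - tr(flexes)\<close>; this is \<open>trace_index_formula\<close>.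

  What remains is \<open>tr(Hv) = \<Gamma>(v) \<Gamma>(sp)\<close>. In the basis of the vectors \<open>1\<^sub>Q i\<close>, with \<open>Q\<close> a vertex orbit
  and \<open>i\<close> a standard basis vector, an orbit moved by \<open>g\<close> contributes nothing to the diagonal
  and a fixed orbit contributes the trace of the linear part of \<open>g\<close>. So the trace on \<open>Hv\<close> is the number
  of fixed orbits, which is the trace of the permutation representation, times the trace of the linear
  part; this is \<open>trace_twisted_pullback\<close>.

  Periodic vertex fields, periodic edge vectors and functions on the set of vertex orbits all are
  functions that are constant on the blocks of a partition with finitely many blocks, and on each of
  the three spaces \<open>g\<close> permutes the blocks and applies an orthogonal map to the values. Finite
  dimension, invariance of the inner product and the trace formula are therefore established once, in
  the locale \<open>block_permutation\<close>.
  Normality of the translation group makes \<open>g\<close> permute orbits, and translations act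
  trivially on periodic vectors, so the trace of the induced representation at \<open>h\<close> is that of \<open>g\<close>.
\<close>

section \<open>Traces on finite-dimensional subspaces\<close>

text \<open>
  Function spaces such as \<open>'v \<Rightarrow> real ^ 'd\<close> are infinite-dimensional, so finite dimension is a
  property of the subspaces under consideration instead of a type class.
\<close>

definition finite_dim :: "'a::real_vector set \<Rightarrow> bool"
  where "finite_dim U \<longleftrightarrow> (\<exists>S. finite S \<and> span S = U)"

lemma finite_dim_imp_subspace: "finite_dim U \<Longrightarrow> subspace U"
  unfolding finite_dim_def by auto

lemma finite_basis_of_subspace:
  fixes U :: "'a::real_vector set"
  assumes "finite_dim U" "subspace W" "W \<subseteq> U"
  obtains B where "finite B" "independent B" "span B = W"
proof -
  obtain S where S: "finite S" "span S = U"
    using assms(1) unfolding finite_dim_def by auto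
  obtain B where B: "B \<subseteq> W" "independent B" "W \<subseteq> span B"
    using maximal_independent_subset by blast
  have "finite B"
    using independent_span_bound[OF S(1) B(2)] B(1) S(2) assms(3) by auto
  moreover have "span B = W"
    using B assms(2) by (meson span_minimal subset_antisym)
  ultimately show thesis using B that by blast
qed

lemma finite_dim_subspace:
  "finite_dim U \<Longrightarrow> subspace W \<Longrightarrow> W \<subseteq> U \<Longrightarrow> finite_dim W"
  by (metis finite_basis_of_subspace finite_dim_def)

text \<open>
  Basis independence of the trace: expanding \<open>b\<close> in \<open>C\<close> and \<open>A c\<close> in \<open>B\<close> turns both sides into the
  double sum over \<open>b\<close> and \<open>c\<close> of the coefficient of \<open>b\<close> at \<open>c\<close> times that of \<open>A c\<close> at \<open>b\<close>.
\<close>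

lemma sum_representation_swap:
  fixes A :: "'a::real_vector \<Rightarrow> 'a"
  assumes B: "finite B" "independent B" and C: "finite C" "independent C"
    and BC: "span B = span C" and A: "linear A" "A ` span C \<subseteq> span C"
  shows "(\<Sum>b\<in>B. representation B (A b) b) = (\<Sum>c\<in>C. representation C (A c) c)"
proof -
  have Ac: "A c \<in> span C" if "c \<in> C" for c
    using A(2) that span_base by blast
  have Ab: "A b = (\<Sum>c\<in>C. representation C b c *\<^sub>R A c)" if "b \<in> B" for b
  proof -
    have "b = (\<Sum>c\<in>C. representation C b c *\<^sub>R c)"
      using sum_representation_eq[OF C(2) _ C(1) order_refl, of b] that BC span_base by metis
    then have "A b = A (\<Sum>c\<in>C. representation C b c *\<^sub>R c)" by simp
    also have "\<dots> = (\<Sum>c\<in>C. representation C b c *\<^sub>R A c)"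
      by (simp add: linear_sum[OF A(1)] linear_scale[OF A(1)] o_def)
    finally show ?thesis .
  qed
  have "(\<Sum>b\<in>B. representation B (A b) b) =
      (\<Sum>b\<in>B. \<Sum>c\<in>C. representation C b c * representation B (A c) b)"
  proof (rule sum.cong[OF refl])
    fix b assume "b \<in> B"
    then show "representation B (A b) b =
        (\<Sum>c\<in>C. representation C b c * representation B (A c) b)"
      using Ac BC by (simp add: Ab representation_sum[OF B(2)] representation_scale[OF B(2)] span_scale)
  qed
  also have "\<dots> = (\<Sum>c\<in>C. \<Sum>b\<in>B. representation C b c * representation B (A c) b)"
    by (rule sum.swap)
  also have "\<dots> = (\<Sum>c\<in>C. representation C (A c) c)"
  proof (rule sum.cong[OF refl])
    fix c assume c: "c \<in> C"
    have "A c = (\<Sum>b\<in>B. representation B (A c) b *\<^sub>R b)"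
      using sum_representation_eq[OF B(2) _ B(1) order_refl, of "A c"] Ac[OF c] BC by simp
    then have "representation C (A c) c =
        representation C (\<Sum>b\<in>B. representation B (A c) b *\<^sub>R b) c" by simp
    also have "\<dots> = (\<Sum>b\<in>B. representation B (A c) b * representation C b c)"
      using BC[symmetric]
      by (simp add: representation_sum[OF C(2)] representation_scale[OF C(2)] span_scale span_base)
    finally show "(\<Sum>b\<in>B. representation C b c * representation B (A c) b) = representation C (A c) c"
      by (simp add: mult.commute)
  qed
  finally show ?thesis .
qed

lemma trace_on_basis:
  fixes A :: "'a::real_vector \<Rightarrow> 'a"
  assumes B: "finite B" "independent B" "span B = U" and A: "linear A" "A ` U \<subseteq> U"
  shows "trace_on U A = (\<Sum>b\<in>B. representation B (A b) b)"
proof -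
  define C where "C = (SOME B. independent B \<and> span B = U)"
  have "\<exists>B. independent B \<and> span B = U" using B by auto
  then have C: "independent C" "span C = U" unfolding C_def by (metis (mono_tags, lifting) someI_ex)+
  have "finite C"
    using independent_span_bound[OF B(1) C(1)] B(3) C(2) span_superset by auto
  then have "(\<Sum>b\<in>C. representation C (A b) b) = (\<Sum>b\<in>B. representation B (A b) b)"
    using B C A by (intro sum_representation_swap) auto
  then show ?thesis unfolding trace_on_def C_def Let_def .
qed

lemma trace_on_matrix:
  fixes A :: "'a::real_vector \<Rightarrow> 'a"
  assumes b: "finite I" "inj_on b I" "independent (b ` I)" "span (b ` I) = U" and A: "linear A"
    and c: "\<And>i. i \<in> I \<Longrightarrow> A (b i) = (\<Sum>j\<in>I. c i j *\<^sub>R b j)"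
  shows "trace_on U A = (\<Sum>i\<in>I. c i i)"
proof -
  have "A (b i) \<in> U" if "i \<in> I" for i
    unfolding c[OF that] b(4)[symmetric] by (intro span_sum span_scale span_base) auto
  then have "A ` U \<subseteq> U"
    unfolding b(4)[symmetric] linear_span_image[OF A, symmetric]
    by (intro span_minimal) (auto)
  then have "trace_on U A = (\<Sum>v\<in>b ` I. representation (b ` I) (A v) v)"
    using b A by (intro trace_on_basis) auto
  also have "\<dots> = (\<Sum>i\<in>I. representation (b ` I) (A (b i)) (b i))"
    using b(2) by (simp add: sum.reindex)
  also have "\<dots> = (\<Sum>i\<in>I. c i i)"
  proof (rule sum.cong[OF refl])
    fix i assume i: "i \<in> I"
    have "representation (b ` I) (A (b i)) (b i) =
        (\<Sum>j\<in>I. c i j * representation (b ` I) (b j) (b i))"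
      using i by (simp add: c representation_sum[OF b(3)] representation_scale[OF b(3)] span_scale span_base)
    also have "\<dots> = (\<Sum>j\<in>I. if j = i then c i j else 0)"
      using i inj_onD[OF b(2)] by (intro sum.cong) (auto simp: representation_basis[OF b(3)])
    finally show "representation (b ` I) (A (b i)) (b i) = c i i"
      using i b(1) by simp
  qed
  finally show ?thesis .
qed

text \<open>
  Concrete spaces come with coordinate functionals \<open>\<phi> i\<close> dual to a family of vectors \<open>b i\<close>. Such a dual
  pair yields independence, spanning and the coefficients of \<open>A (b i)\<close> at the same time.
\<close>

lemma
  fixes A :: "'a::real_vector \<Rightarrow> 'a" and \<phi> :: "'i \<Rightarrow> 'a \<Rightarrow> real"
  assumes U: "subspace U" and I: "finite I" and b: "\<And>i. i \<in> I \<Longrightarrow> b i \<in> U"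
    and \<phi>: "\<And>i. i \<in> I \<Longrightarrow> linear (\<phi> i)"
    and dual: "\<And>i j. i \<in> I \<Longrightarrow> j \<in> I \<Longrightarrow> \<phi> i (b j) = (if i = j then 1 else 0)"
    and expand: "\<And>u. u \<in> U \<Longrightarrow> u = (\<Sum>i\<in>I. \<phi> i u *\<^sub>R b i)"
  shows finite_dim_dual_basis: "finite_dim U"
    and trace_on_dual_basis: "linear A \<Longrightarrow> A ` U \<subseteq> U \<Longrightarrow> trace_on U A = (\<Sum>i\<in>I. \<phi> i (A (b i)))"
proof -
  have span: "span (b ` I) = U"
  proof
    show "span (b ` I) \<subseteq> U" using b U by (intro span_minimal) auto
    have "(\<Sum>i\<in>I. \<phi> i u *\<^sub>R b i) \<in> span (b ` I)" for u
      by (intro span_sum span_scale span_base) auto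
    then show "U \<subseteq> span (b ` I)" using expand by (metis subsetI)
  qed
  then show "finite_dim U" unfolding finite_dim_def using I by blast
  have inj: "inj_on b I"
    by (rule inj_onI) (metis dual zero_neq_one)
  have indep: "independent (b ` I)"
  proof (rule independent_if_scalars_zero)
    fix f x assume 0: "(\<Sum>x\<in>b ` I. f x *\<^sub>R x) = 0" and "x \<in> b ` I"
    then obtain i where i: "i \<in> I" "x = b i" by auto
    have "0 = \<phi> i (\<Sum>j\<in>I. f (b j) *\<^sub>R b j)"
      using 0 inj linear_0[OF \<phi>[OF i(1)]] by (simp add: sum.reindex)
    also have "\<dots> = (\<Sum>j\<in>I. if j = i then f (b j) else 0)"
      using i(1) by (auto simp: linear_sum[OF \<phi>[OF i(1)]] linear_scale[OF \<phi>[OF i(1)]] dual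
          intro!: sum.cong)
    finally show "f x = 0" using i I by simp
  qed (use I in auto)
  show "trace_on U A = (\<Sum>i\<in>I. \<phi> i (A (b i)))" if "linear A" "A ` U \<subseteq> U"
    using that b expand
    by (intro trace_on_matrix[OF I inj indep span, of A "\<lambda>i j. \<phi> j (A (b i))"]) auto
qed

text \<open>
  The basis chosen in \<open>trace_on\<close> lies in \<open>U\<close>, so values outside \<open>U\<close> do not matter. This
  applies to induced representations, whose values are maps restricted to the representation space.
\<close>

lemma trace_on_cong:
  fixes A :: "'a::real_vector \<Rightarrow> 'a"
  assumes "subspace U" and eq: "\<And>u. u \<in> U \<Longrightarrow> A u = A' u"
  shows "trace_on U A = trace_on U A'"
proof -
  define B where "B = (SOME B. independent B \<and> span B = U)"
  have "\<exists>B. independent B \<and> span B = U"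
    using maximal_independent_subset[of U] assms(1) by (metis span_minimal subset_antisym)
  then have "span B = U" unfolding B_def by (metis (mono_tags, lifting) someI_ex)
  then have "A b = A' b" if "b \<in> B" for b using that eq span_base by blast
  then show ?thesis
    unfolding trace_on_def B_def[symmetric] Let_def by (intro sum.cong) auto
qed

text \<open>
  A basis of \<open>X\<close> is mapped to a basis of \<open>f ` X\<close> with respect to which \<open>B\<close> has the matrix of \<open>A\<close>.
\<close>

lemma trace_on_iso:
  fixes f :: "'a::real_vector \<Rightarrow> 'b::real_vector"
  assumes X: "finite_dim X" and f: "linear f" "inj_on f X" and A: "linear A" "A ` X \<subseteq> X"
    and B: "linear B" and fA: "\<And>x. x \<in> X \<Longrightarrow> f (A x) = B (f x)"
  shows "trace_on (f ` X) B = trace_on X A"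
proof -
  obtain C where C: "finite C" "independent C" "span C = X"
    using finite_basis_of_subspace[OF X finite_dim_imp_subspace[OF X] order_refl] by blast
  have CX: "C \<subseteq> X" using C(3) span_superset by blast
  have fC: "independent (f ` C)"
    using C f by (intro linear_independent_injective_image[OF f(1)]) auto
  have "trace_on (f ` X) B = (\<Sum>c\<in>C. representation C (A c) c)"
  proof (rule trace_on_matrix[OF C(1), of f _ _ "\<lambda>c d. representation C (A c) d"])
    show "inj_on f C" using f(2) CX by (rule inj_on_subset)
    show "independent (f ` C)" by fact
    show "span (f ` C) = f ` X" by (simp add: linear_span_image[OF f(1)] C(3))
    fix c assume c: "c \<in> C"
    have "A c \<in> span C" using A(2) c CX C(3) by blast
    then have "A c = (\<Sum>d\<in>C. representation C (A c) d *\<^sub>R d)"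
      using sum_representation_eq[OF C(2) _ C(1) order_refl] by simp
    then have "f (A c) = f (\<Sum>d\<in>C. representation C (A c) d *\<^sub>R d)" by simp
    then show "B (f c) = (\<Sum>d\<in>C. representation C (A c) d *\<^sub>R f d)"
      using fA c CX by (auto simp: linear_sum[OF f(1)] linear_scale[OF f(1)] o_def)
  qed (rule B)
  also have "\<dots> = trace_on X A"
    using C A by (intro trace_on_basis[symmetric])
  finally show ?thesis .
qed

text \<open>
  The union of a basis of \<open>W\<close> and a basis of \<open>X\<close> is a basis of \<open>U\<close> in which \<open>A\<close> is block diagonal.
\<close>

lemma trace_on_direct_sum:
  fixes A :: "'a::real_vector \<Rightarrow> 'a"
  assumes U: "finite_dim U" and W: "subspace W" "W \<subseteq> U" and X: "subspace X" "X \<subseteq> U"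
    and WX: "W \<inter> X = {0}" and sum: "\<And>u. u \<in> U \<Longrightarrow> \<exists>w\<in>W. \<exists>x\<in>X. u = w + x"
    and A: "linear A" "A ` W \<subseteq> W" "A ` X \<subseteq> X"
  shows "trace_on U A = trace_on W A + trace_on X A"
proof -
  obtain B where B: "finite B" "independent B" "span B = W"
    using finite_basis_of_subspace[OF U W] .
  obtain C where C: "finite C" "independent C" "span C = X"
    using finite_basis_of_subspace[OF U X] .
  have disj: "B \<inter> C = {}"
  proof (rule ccontr)
    assume "B \<inter> C \<noteq> {}"
    then obtain x where x: "x \<in> B" "x \<in> C" by auto
    then have "x = 0" using WX B(3) C(3) span_base[OF x(1)] span_base[OF x(2)] by auto
    then show False using x B(2) dependent_zero by blast
  qed
  have indep: "independent (B \<union> C)"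
  proof (rule independent_if_scalars_zero)
    fix f x assume "(\<Sum>x\<in>B \<union> C. f x *\<^sub>R x) = 0" and x: "x \<in> B \<union> C"
    then have 0: "(\<Sum>x\<in>B. f x *\<^sub>R x) + (\<Sum>x\<in>C. f x *\<^sub>R x) = 0"
      using sum.union_disjoint[OF B(1) C(1) disj] by metis
    have w: "(\<Sum>x\<in>B. f x *\<^sub>R x) \<in> W"
      unfolding B(3)[symmetric] by (intro span_sum span_scale span_base)
    have x': "(\<Sum>x\<in>C. f x *\<^sub>R x) \<in> X"
      unfolding C(3)[symmetric] by (intro span_sum span_scale span_base)
    have "(\<Sum>x\<in>B. f x *\<^sub>R x) = - (\<Sum>x\<in>C. f x *\<^sub>R x)" using 0 by (simp add: eq_neg_iff_add_eq_0)
    then have "(\<Sum>x\<in>B. f x *\<^sub>R x) \<in> W \<inter> X" using w subspace_neg[OF X(1) x'] by simp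
    then have "(\<Sum>x\<in>B. f x *\<^sub>R x) = 0" "(\<Sum>x\<in>C. f x *\<^sub>R x) = 0" using WX 0 by auto
    then show "f x = 0"
      using x independentD[OF B(2,1) order_refl, of f x] independentD[OF C(2,1) order_refl, of f x]
      by auto
  qed (use B C in auto)
  have span: "span (B \<union> C) = U"
  proof
    show "span (B \<union> C) \<subseteq> U"
      using B(3) C(3) W X span_superset[of B] span_superset[of C] finite_dim_imp_subspace[OF U]
      by (intro span_minimal) auto
    show "U \<subseteq> span (B \<union> C)"
      unfolding span_Un using sum B(3) C(3) by blast
  qed
  have AU: "A ` U \<subseteq> U"
  proof
    fix y assume "y \<in> A ` U"
    then obtain w x where "w \<in> W" "x \<in> X" "y = A w + A x"
      using sum linear_add[OF A(1)] by (metis imageE)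
    then show "y \<in> U"
      using A(2,3) W X subspace_add[OF finite_dim_imp_subspace[OF U]] by blast
  qed
  have "trace_on U A = (\<Sum>v\<in>B \<union> C. representation (B \<union> C) (A v) v)"
    using B C indep span A AU by (intro trace_on_basis) auto
  also have "\<dots> = (\<Sum>v\<in>B. representation (B \<union> C) (A v) v) + (\<Sum>v\<in>C. representation (B \<union> C) (A v) v)"
    by (rule sum.union_disjoint[OF B(1) C(1) disj])
  also have "(\<Sum>v\<in>B. representation (B \<union> C) (A v) v) = (\<Sum>v\<in>B. representation B (A v) v)"
    using A(2) B(3) span_base[of _ B]
    by (intro sum.cong refl fun_cong[OF representation_extend[OF indep]]) auto
  also have "(\<Sum>v\<in>C. representation (B \<union> C) (A v) v) = (\<Sum>v\<in>C. representation C (A v) v)"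
    using A(3) C(3) span_base[of _ C]
    by (intro sum.cong refl fun_cong[OF representation_extend[OF indep]]) auto
  finally show ?thesis
    using trace_on_basis[OF B A(1,2)] trace_on_basis[OF C A(1,3)] by simp
qed

definition orth_compl :: "('a \<Rightarrow> 'a \<Rightarrow> real) \<Rightarrow> 'a set \<Rightarrow> 'a set \<Rightarrow> 'a set"
  where "orth_compl f U W = {u \<in> U. \<forall>w\<in>W. f u w = 0}"

text \<open>
  The forms at hand evaluate functions at representatives of orbits. They are bilinear on all
  functions, but vectors of length zero are excluded only on the subspace \<open>U\<close> of periodic ones.
  Orthogonal decomposition rests on this absence of isotropic vectors.
\<close>

definition anisotropic_form_on :: "'a::real_vector set \<Rightarrow> ('a \<Rightarrow> 'a \<Rightarrow> real) \<Rightarrow> bool"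
  where "anisotropic_form_on U f \<longleftrightarrow>
    bilinear f \<and> (\<forall>u v. f u v = f v u) \<and> (\<forall>u\<in>U. f u u = 0 \<longrightarrow> u = 0)"

lemma anisotropic_form_on_subset: "anisotropic_form_on U f \<Longrightarrow> W \<subseteq> U \<Longrightarrow> anisotropic_form_on W f"
  unfolding anisotropic_form_on_def by blast

lemma subspace_orth_compl:
  assumes "subspace U" "anisotropic_form_on U f"
  shows "subspace (orth_compl f U W)"
proof -
  have "bilinear f" using assms(2) unfolding anisotropic_form_on_def by blast
  then show ?thesis
    using assms(1) unfolding orth_compl_def subspace_def
    by (simp add: bilinear_ladd bilinear_lmul bilinear_lzero)
qed

text \<open>
  One step of the Gram-Schmidt process: the new generator \<open>s\<close> is replaced by its component \<open>s2\<close>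
  orthogonal to the span of the previous ones, and the projection of \<open>u\<close> on \<open>s2\<close> is split off.
\<close>

lemma orth_decomposition_span:
  fixes U :: "'a::real_vector set"
  assumes "subspace U" and f: "anisotropic_form_on U f" and "finite S" "S \<subseteq> U" "u \<in> U"
  shows "\<exists>w\<in>span S. \<exists>x\<in>orth_compl f U (span S). u = w + x"
  using assms(3-5)
proof (induction S arbitrary: u rule: finite_induct)
  case empty
  then show ?case
    using f unfolding orth_compl_def anisotropic_form_on_def by (auto simp: bilinear_rzero)
next
  case (insert s S)
  have bil: "bilinear f" and sym: "\<And>u v. f u v = f v u"
    and def: "\<And>u. u \<in> U \<Longrightarrow> f u u = 0 \<Longrightarrow> u = 0"
    using f unfolding anisotropic_form_on_def by auto
  obtain s1 s2 where s1: "s1 \<in> span S" and s2: "s2 \<in> U" "\<And>w. w \<in> span S \<Longrightarrow> f s2 w = 0"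
    and s: "s = s1 + s2"
    using insert.IH[of s] insert.prems unfolding orth_compl_def by auto
  obtain a b where a: "a \<in> span S" and b: "b \<in> U" "\<And>w. w \<in> span S \<Longrightarrow> f b w = 0"
    and u: "u = a + b"
    using insert.IH[of u] insert.prems unfolding orth_compl_def by auto
  define k where "k = f b s2 / f s2 s2"
  have sub: "span S \<subseteq> span (insert s S)" by (intro span_mono) auto
  have "s2 = s - s1" using s by simp
  then have s2_in: "s2 \<in> span (insert s S)"
    using s1 sub by (auto intro: span_diff span_base)
  have w: "a + k *\<^sub>R s2 \<in> span (insert s S)"
    using a sub s2_in by (auto intro: span_add span_scale)
  \<comment> \<open>If \<open>s2 = 0\<close>, then \<open>k = 0\<close> by division by zero, and the equation still holds.\<close>
  have ks2: "f b s2 = k * f s2 s2"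
    using def[OF s2(1)] unfolding k_def by (cases "f s2 s2 = 0") (auto simp: bilinear_rzero[OF bil])
  have "f (b - k *\<^sub>R s2) w = 0" if w: "w \<in> span (insert s S)" for w
  proof -
    obtain m where "w - m *\<^sub>R s \<in> span S" using w span_breakdown_eq[of w s S] by blast
    then have w0: "w - m *\<^sub>R s + m *\<^sub>R s1 \<in> span S" using s1 by (intro span_add span_scale)
    have "w = (w - m *\<^sub>R s + m *\<^sub>R s1) + m *\<^sub>R s2" by (simp add: s algebra_simps)
    then have "f (b - k *\<^sub>R s2) w =
        f (b - k *\<^sub>R s2) (w - m *\<^sub>R s + m *\<^sub>R s1) + m * f (b - k *\<^sub>R s2) s2"
      by (metis bilinear_radd[OF bil] bilinear_rmul[OF bil] real_scaleR_def)
    then show ?thesis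
      using w0 b s2 ks2
      by (simp add: bilinear_lsub[OF bil] bilinear_lmul[OF bil])
  qed
  moreover have "b - k *\<^sub>R s2 \<in> U" using b s2 assms(1) by (intro subspace_diff subspace_scale)
  ultimately have "b - k *\<^sub>R s2 \<in> orth_compl f U (span (insert s S))"
    unfolding orth_compl_def by auto
  moreover have "u = (a + k *\<^sub>R s2) + (b - k *\<^sub>R s2)" using u by simp
  ultimately show ?case using w by blast
qed

lemma orth_decomposition:
  assumes "finite_dim U" "anisotropic_form_on U f" "subspace W" "W \<subseteq> U" "u \<in> U"
  shows "\<exists>w\<in>W. \<exists>x\<in>orth_compl f U W. u = w + x"
proof -
  obtain S where "finite S" "span S = W"
    using finite_basis_of_subspace[OF assms(1,3,4)] by metis
  then show ?thesis
    using orth_decomposition_span[OF finite_dim_imp_subspace[OF assms(1)] assms(2), of S u]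
      assms(4,5) span_superset by blast
qed

text \<open>
  Each vector of \<open>W\<close> has the form \<open>A w\<close>, and \<open>A u\<close> is as orthogonal to \<open>A w\<close> as \<open>u\<close> is to \<open>w\<close>. This
  is why invariance of \<open>W\<close> is required as \<open>W \<subseteq> A ` W\<close>.
\<close>

lemma orth_compl_invariant:
  assumes "A ` U \<subseteq> U" "W \<subseteq> U" "W \<subseteq> A ` W"
    and iso: "\<And>u v. u \<in> U \<Longrightarrow> v \<in> U \<Longrightarrow> f (A u) (A v) = f u v"
  shows "A ` orth_compl f U W \<subseteq> orth_compl f U W"
proof
  fix y assume "y \<in> A ` orth_compl f U W"
  then obtain u where u: "u \<in> U" "\<And>w. w \<in> W \<Longrightarrow> f u w = 0" and y: "y = A u"
    unfolding orth_compl_def by auto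
  have "f (A u) w = 0" if w: "w \<in> W" for w
  proof -
    obtain w' where "w' \<in> W" "w = A w'" using w assms(3) by blast
    then show ?thesis using u iso assms(2) by auto
  qed
  then show "y \<in> orth_compl f U W"
    using u(1) assms(1) unfolding y orth_compl_def by blast
qed

lemma trace_on_orth_compl:
  fixes A :: "'a::real_vector \<Rightarrow> 'a"
  assumes U: "finite_dim U" and f: "anisotropic_form_on U f" and W: "subspace W" "W \<subseteq> U"
    and A: "linear A" "A ` U \<subseteq> U" "A ` W = W"
    and iso: "\<And>u v. u \<in> U \<Longrightarrow> v \<in> U \<Longrightarrow> f (A u) (A v) = f u v"
  shows "trace_on U A = trace_on W A + trace_on (orth_compl f U W) A"
proof (rule trace_on_direct_sum[OF U W])
  note sU = finite_dim_imp_subspace[OF U]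
  show sX: "subspace (orth_compl f U W)" by (rule subspace_orth_compl[OF sU f])
  show "orth_compl f U W \<subseteq> U" unfolding orth_compl_def by auto
  have "x = 0" if "x \<in> W" "x \<in> orth_compl f U W" for x
    using that f unfolding orth_compl_def anisotropic_form_on_def by auto
  then show "W \<inter> orth_compl f U W = {0}"
    using subspace_0[OF W(1)] subspace_0[OF sX] by auto
  show "\<exists>w\<in>W. \<exists>x\<in>orth_compl f U W. u = w + x" if "u \<in> U" for u
    by (rule orth_decomposition[OF U f W that])
  show "A ` W \<subseteq> W" using A(3) by simp
  show "A ` orth_compl f U W \<subseteq> orth_compl f U W"
    using iso by (rule orth_compl_invariant[OF A(2) W(2) equalityD2[OF A(3)]])
qed (rule A(1))

text \<open>
  Write \<open>N\<close> for the kernel of \<open>R\<close> on \<open>U\<close> and \<open>X\<close> for its orthogonal complement. The traces add up along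
  \<open>U = N \<oplus> X\<close>, \<open>N = K \<oplus> K\<^sup>\<bottom>\<close> and \<open>W = R U \<oplus> (R U)\<^sup>\<bottom>\<close>, and the two terms for \<open>X\<close> and \<open>R U\<close> agree because \<open>R\<close>
  maps \<open>X\<close> isomorphically and equivariantly onto \<open>R U\<close>.
\<close>

lemma trace_index_formula:
  fixes R :: "'a::real_vector \<Rightarrow> 'b::real_vector"
  assumes U: "finite_dim U" "anisotropic_form_on U f"
    and A: "linear A" "A ` U = U" "\<And>u v. u \<in> U \<Longrightarrow> v \<in> U \<Longrightarrow> f (A u) (A v) = f u v"
    and W: "finite_dim W" "anisotropic_form_on W k"
    and B: "linear B" "B ` W \<subseteq> W" "\<And>u v. u \<in> W \<Longrightarrow> v \<in> W \<Longrightarrow> k (B u) (B v) = k u v"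
    and R: "linear R" "R ` U \<subseteq> W" "\<And>u. u \<in> U \<Longrightarrow> R (A u) = B (R u)"
    and K: "subspace K" "K \<subseteq> U" "\<And>u. u \<in> K \<Longrightarrow> R u = 0" "A ` K = K"
  shows "trace_on (orth_compl f {u \<in> U. R u = 0} K) A - trace_on (orth_compl k W (R ` U)) B =
    trace_on U A - trace_on W B - trace_on K A"
proof -
  define N where "N = {u \<in> U. R u = 0}"
  define X where "X = orth_compl f U N"
  note sU = finite_dim_imp_subspace[OF U(1)]
  have N: "subspace N" "N \<subseteq> U"
    using sU unfolding N_def subspace_def
    by (auto simp: linear_0[OF R(1)] linear_add[OF R(1)] linear_scale[OF R(1)])
  have RU: "subspace (R ` U)" by (rule linear_subspace_image[OF R(1) sU])
  have B_inj: "w = 0" if "w \<in> W" "B w = 0" for w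
  proof -
    have "k w w = k 0 0" using B(3)[of w w] that by simp
    then show ?thesis
      using W(2) that unfolding anisotropic_form_on_def by (auto simp: bilinear_lzero)
  qed
  \<comment> \<open>Surjectivity on \<open>N\<close>: if \<open>A u\<close> is in the kernel, then so is \<open>u\<close>, as \<open>B\<close> is injective on \<open>W\<close>.\<close>
  have AN: "A ` N = N"
  proof
    show "A ` N \<subseteq> N" using A(2) R(3) linear_0[OF B(1)] unfolding N_def by auto
    show "N \<subseteq> A ` N"
    proof
      fix u assume u: "u \<in> N"
      then obtain u' where u': "u' \<in> U" "u = A u'" using A(2) unfolding N_def by auto
      then have "B (R u') = 0" using R(3) u unfolding N_def by simp
      then have "R u' = 0" using B_inj R(2) u'(1) by blast
      then show "u \<in> A ` N" using u' unfolding N_def by auto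
    qed
  qed
  have X: "subspace X" "X \<subseteq> U"
    using subspace_orth_compl[OF sU U(2)] unfolding X_def orth_compl_def by auto
  have AX: "A ` X \<subseteq> X"
    unfolding X_def using A(3)
    by (rule orth_compl_invariant[OF equalityD1[OF A(2)] N(2) equalityD2[OF AN]])
  have decomp: "\<exists>w\<in>N. \<exists>x\<in>X. u = w + x" if "u \<in> U" for u
    unfolding X_def by (rule orth_decomposition[OF U N that])
  have RX: "R ` X = R ` U"
  proof
    show "R ` U \<subseteq> R ` X"
    proof
      fix y assume "y \<in> R ` U"
      then obtain w x where "w \<in> N" "x \<in> X" "y = R (w + x)" using decomp by blast
      then show "y \<in> R ` X" by (auto simp: N_def linear_add[OF R(1)])
    qed
  qed (use X in auto)
  have "x = 0" if "x \<in> X" "R x = 0" for x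
    using that U(2) unfolding X_def N_def orth_compl_def anisotropic_form_on_def by auto
  then have inj: "inj_on R X"
    using linear_inj_on_iff_eq_0[OF R(1) X(1)] by auto
  have BRU: "B ` R ` U = R ` U"
  proof -
    have "B ` R ` U = R ` A ` U" unfolding image_image using R(3) by (intro image_cong) auto
    then show ?thesis using A(2) by simp
  qed
  have "trace_on U A = trace_on N A + trace_on X A"
    unfolding X_def using A(3)
    by (rule trace_on_orth_compl[OF U N A(1) equalityD1[OF A(2)] AN])
  moreover have "trace_on (R ` X) B = trace_on X A"
    using R(3) X(2)
    by (intro trace_on_iso[OF finite_dim_subspace[OF U(1) X] R(1) inj A(1) AX B(1)]) blast
  moreover have "trace_on W B = trace_on (R ` U) B + trace_on (orth_compl k W (R ` U)) B"
    using B(3) by (rule trace_on_orth_compl[OF W RU R(2) B(1,2) BRU])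
  moreover have "trace_on N A = trace_on K A + trace_on (orth_compl f N K) A"
  proof (rule trace_on_orth_compl[OF finite_dim_subspace[OF U(1) N]
        anisotropic_form_on_subset[OF U(2) N(2)] K(1) _ A(1) equalityD1[OF AN] K(4)])
    show "K \<subseteq> N" using K unfolding N_def by blast
    show "f (A u) (A v) = f u v" if "u \<in> N" "v \<in> N" for u v
      using that A(3) N(2) by blast
  qed
  ultimately show ?thesis using RX unfolding N_def by simp
qed

section \<open>Functions that are constant on the blocks of a partition\<close>

text \<open>
  For the partition into orbits of a group these are the invariant functions, extended by zero to
  points outside the set on which the group acts.
\<close>

definition block_functions :: "'x set set \<Rightarrow> ('x \<Rightarrow> 'b::real_vector) set"
  where "block_functions P =
    {u. (\<forall>Q\<in>P. \<forall>x\<in>Q. \<forall>y\<in>Q. u x = u y) \<and> (\<forall>x. x \<notin> \<Union>P \<longrightarrow> u x = 0)}"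

definition block_inner :: "'x set set \<Rightarrow> ('x \<Rightarrow> 'b::real_inner) \<Rightarrow> ('x \<Rightarrow> 'b) \<Rightarrow> real"
  where "block_inner P u u' = (\<Sum>Q\<in>P. u (SOME x. x \<in> Q) \<bullet> u' (SOME x. x \<in> Q))"

text \<open>
  With \<open>\<tau>\<close> the inverse of the permutation given by a symmetry and \<open>S\<close> its linear part this is the
  representation on vector fields; with \<open>S\<close> the identity it is a permutation representation.
\<close>

definition twisted_pullback :: "('b \<Rightarrow> 'b) \<Rightarrow> ('x \<Rightarrow> 'x) \<Rightarrow> ('x \<Rightarrow> 'b) \<Rightarrow> 'x \<Rightarrow> 'b"
  where "twisted_pullback S \<tau> u = (\<lambda>x. S (u (\<tau> x)))"

lemma sum_fun_apply: "(\<Sum>i\<in>I. f i) x = (\<Sum>i\<in>I. f i x :: 'b::real_vector)"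
  by (induction I rule: infinite_finite_induct) auto

lemma linear_twisted_pullback: "linear S \<Longrightarrow> linear (twisted_pullback S \<tau>)"
  by (intro linearI)
    (simp_all add: twisted_pullback_def fun_eq_iff scaleR_fun_def linear_add linear_scale)

lemma block_functionsI:
  "(\<And>Q x y. Q \<in> P \<Longrightarrow> x \<in> Q \<Longrightarrow> y \<in> Q \<Longrightarrow> u x = u y) \<Longrightarrow>
    (\<And>x. x \<notin> \<Union>P \<Longrightarrow> u x = 0) \<Longrightarrow> u \<in> block_functions P"
  unfolding block_functions_def by blast

lemma block_functions_eq: "u \<in> block_functions P \<Longrightarrow> Q \<in> P \<Longrightarrow> x \<in> Q \<Longrightarrow> y \<in> Q \<Longrightarrow> u x = u y"
  unfolding block_functions_def by blast

lemma block_functions_zero: "u \<in> block_functions P \<Longrightarrow> x \<notin> \<Union>P \<Longrightarrow> u x = 0"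
  unfolding block_functions_def by blast

lemma subspace_block_functions: "subspace (block_functions P)"
proof (rule subspaceI)
  fix u v :: "'a \<Rightarrow> 'b" and c :: real
  assume u: "u \<in> block_functions P"
  show "c *\<^sub>R u \<in> block_functions P"
    unfolding scaleR_fun_def
    by (intro block_functionsI arg_cong[where f = "(*\<^sub>R) c"] block_functions_eq[OF u])
      (auto simp: block_functions_zero[OF u])
  assume v: "v \<in> block_functions P"
  show "u + v \<in> block_functions P"
    unfolding plus_fun_def
    by (intro block_functionsI arg_cong2[where f = "(+)"] block_functions_eq[OF u]
        block_functions_eq[OF v])
      (auto simp: block_functions_zero[OF u] block_functions_zero[OF v])
qed (simp add: block_functions_def)

lemma bilinear_block_inner: "bilinear (block_inner P)"
  unfolding bilinear_def block_inner_def
  by (intro conjI allI linearI)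
    (simp_all add: inner_add_left inner_add_right sum.distrib scaleR_fun_def sum_distrib_left)

locale block_permutation =
  fixes X :: "'x set" and P :: "'x set set" and \<tau> :: "'x \<Rightarrow> 'x"
  assumes finite_blocks: "finite P"
    and partition: "partition_on X P"
    and bij: "bij \<tau>"
    and blocks: "Q \<in> P \<Longrightarrow> \<tau> ` Q \<in> P"
begin

abbreviation rep :: "'x set \<Rightarrow> 'x"
  where "rep Q \<equiv> SOME x. x \<in> Q"

lemma rep_in: "Q \<in> P \<Longrightarrow> rep Q \<in> Q"
  using partition_onD3[OF partition] by (metis ex_in_conv someI_ex)

lemma block_eqI: "Q \<in> P \<Longrightarrow> Q' \<in> P \<Longrightarrow> x \<in> Q \<Longrightarrow> x \<in> Q' \<Longrightarrow> Q = Q'"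
  using partition_onD2[OF partition] unfolding disjoint_def by blast

text \<open>
  An injective map of a finite set of blocks to itself is onto.
\<close>

lemma image_blocks: "(`) \<tau> ` P = P" and inj_on_blocks: "inj_on ((`) \<tau>) P"
proof -
  show "inj_on ((`) \<tau>) P"
    using bij_is_inj[OF bij] by (meson inj_image_eq_iff inj_onI)
  then show "(`) \<tau> ` P = P"
    using blocks by (intro endo_inj_surj finite_blocks) auto
qed

lemma mem_Union_blocks_iff: "\<tau> x \<in> \<Union>P \<longleftrightarrow> x \<in> \<Union>P"
proof
  assume "\<tau> x \<in> \<Union>P"
  then obtain Q where "Q \<in> P" "\<tau> x \<in> \<tau> ` Q" using image_blocks by blast
  then show "x \<in> \<Union>P" using bij_is_inj[OF bij] by (metis UnionI inj_image_mem_iff)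
qed (use blocks in blast)

lemma value_at_rep: "u \<in> block_functions P \<Longrightarrow> Q \<in> P \<Longrightarrow> x \<in> Q \<Longrightarrow> u (rep Q) = u x"
  using rep_in unfolding block_functions_def by blast

lemma anisotropic_block_inner:
  "anisotropic_form_on (block_functions P) (block_inner P)"
proof -
  have "u = 0" if u: "u \<in> block_functions P" and 0: "block_inner P u u = 0" for u :: "'x \<Rightarrow> 'b::real_inner"
  proof
    fix x
    show "u x = 0 x"
    proof (cases "x \<in> \<Union>P")
      case True
      then obtain Q where Q: "Q \<in> P" "x \<in> Q" by auto
      have "u (rep Q) \<bullet> u (rep Q) = 0"
        using 0 Q(1) finite_blocks unfolding block_inner_def
        by (subst (asm) sum_nonneg_eq_0_iff) auto
      then show ?thesis using value_at_rep[OF u Q] by simp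
    qed (use u in \<open>auto simp: block_functions_def\<close>)
  qed
  then show ?thesis
    unfolding anisotropic_form_on_def using bilinear_block_inner
    by (auto simp: block_inner_def inner_commute)
qed

lemma twisted_pullback_mem:
  assumes "S 0 = 0" "u \<in> block_functions P"
  shows "twisted_pullback S \<tau> u \<in> block_functions P"
  unfolding twisted_pullback_def
proof (rule block_functionsI)
  show "S (u (\<tau> x)) = S (u (\<tau> y))" if "Q \<in> P" "x \<in> Q" "y \<in> Q" for Q x y
    using block_functions_eq[OF assms(2) blocks[OF that(1)] imageI[OF that(2)] imageI[OF that(3)]]
    by simp
  show "S (u (\<tau> x)) = 0" if "x \<notin> \<Union>P" for x
    using block_functions_zero[OF assms(2), of "\<tau> x"] that assms(1) mem_Union_blocks_iff[of x]
    by simp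
qed

lemma block_permutation_inv: "block_permutation X P (inv_into UNIV \<tau>)"
proof (rule block_permutation.intro[OF finite_blocks partition bij_imp_bij_inv[OF bij]])
  fix Q assume "Q \<in> P"
  then obtain Q' where "Q' \<in> P" "Q = \<tau> ` Q'" using image_blocks by blast
  then show "inv_into UNIV \<tau> ` Q \<in> P" using bij_is_inj[OF bij] by (simp add: image_inv_f_f)
qed

text \<open>
  A preimage is obtained by the same construction from the inverses of \<open>S\<close> and \<open>\<tau>\<close>; the inverse of \<open>\<tau>\<close>
  permutes the blocks as well.
\<close>

lemma twisted_pullback_image:
  fixes S :: "'b::euclidean_space \<Rightarrow> 'b"
  assumes S: "orthogonal_transformation S"
  shows "twisted_pullback S \<tau> ` block_functions P = block_functions P"
proof
  have S0: "S 0 = 0" "inv_into UNIV S 0 = 0"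
    using S orthogonal_transformation_inv[OF S]
    by (auto intro!: linear_0 orthogonal_transformation_linear)
  show "twisted_pullback S \<tau> ` block_functions P \<subseteq> block_functions P"
    using twisted_pullback_mem S0(1) by blast
  show "block_functions P \<subseteq> twisted_pullback S \<tau> ` block_functions P"
  proof
    fix u :: "'x \<Rightarrow> 'b" assume u: "u \<in> block_functions P"
    interpret i: block_permutation X P "inv_into UNIV \<tau>" by (rule block_permutation_inv)
    have "twisted_pullback S \<tau> (twisted_pullback (inv_into UNIV S) (inv_into UNIV \<tau>) u) = u"
      using orthogonal_transformation_bij[OF S] bij
      by (simp add: twisted_pullback_def bij_is_surj bij_is_inj surj_f_inv_f inv_f_f)
    then show "u \<in> twisted_pullback S \<tau> ` block_functions P"
      using i.twisted_pullback_mem[where S = "inv_into UNIV S", OF S0(2) u] by (metis imageI)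
  qed
qed

text \<open>
  Isometry of \<open>S\<close> leaves the sum over the blocks \<open>Q\<close> of the products of values on \<open>\<tau> ` Q\<close>, which is a
  reindexing of the original sum. The representatives need not correspond: \<open>\<tau>\<close> of the representative
  of \<open>Q\<close> is merely some point of \<open>\<tau> ` Q\<close>, at which the functions have the right value.
\<close>

lemma block_inner_twisted_pullback:
  assumes S: "orthogonal_transformation S"
    and u: "u \<in> block_functions P" "u' \<in> block_functions P"
  shows "block_inner P (twisted_pullback S \<tau> u) (twisted_pullback S \<tau> u') = block_inner P u u'"
proof -
  have "block_inner P (twisted_pullback S \<tau> u) (twisted_pullback S \<tau> u') =
      (\<Sum>Q\<in>P. u (\<tau> (rep Q)) \<bullet> u' (\<tau> (rep Q)))"
    using S by (simp add: block_inner_def twisted_pullback_def orthogonal_transformation_def)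
  also have "\<dots> = (\<Sum>Q\<in>P. u (rep (\<tau> ` Q)) \<bullet> u' (rep (\<tau> ` Q)))"
  proof (rule sum.cong[OF refl])
    fix Q assume Q: "Q \<in> P"
    note at_rep = value_at_rep[OF _ blocks[OF Q] imageI[OF rep_in[OF Q]]]
    show "u (\<tau> (rep Q)) \<bullet> u' (\<tau> (rep Q)) = u (rep (\<tau> ` Q)) \<bullet> u' (rep (\<tau> ` Q))"
      unfolding at_rep[OF u(1)] at_rep[OF u(2)] ..
  qed
  also have "\<dots> = (\<Sum>Q\<in>(`) \<tau> ` P. u (rep Q) \<bullet> u' (rep Q))"
    unfolding sum.reindex[OF inj_on_blocks] o_def ..
  also have "\<dots> = block_inner P u u'"
    unfolding image_blocks block_inner_def ..
  finally show ?thesis .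
qed

text \<open>
  The functions equal to a basis vector \<open>i\<close> on the block \<open>Q\<close> and zero elsewhere form a basis, dual to
  the functionals that take the \<open>i\<close>-th coordinate at the representative of \<open>Q\<close>. The diagonal coefficient
  of the pullback at \<open>(Q, i)\<close> is \<open>S i \<bullet> i\<close> if \<open>\<tau>\<close> maps \<open>Q\<close> to itself, and zero otherwise.
\<close>

lemma finite_dim_block_functions:
    "finite_dim (block_functions P :: ('x \<Rightarrow> 'b::euclidean_space) set)" (is ?fin)
  and trace_twisted_pullback:
    "orthogonal_transformation S \<Longrightarrow> trace_on (block_functions P) (twisted_pullback S \<tau>) =
      real (card {Q \<in> P. \<tau> ` Q = Q}) * (\<Sum>i\<in>Basis. S i \<bullet> (i::'b))"
proof -
  let ?b = "\<lambda>(Q, i::'b) x. if x \<in> Q then i else 0"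
  let ?\<phi> = "\<lambda>(Q, i::'b) u. u (rep Q) \<bullet> i"
  have I: "finite (P \<times> (Basis :: 'b set))" using finite_blocks by simp
  have b: "?b a \<in> block_functions P" if aP: "a \<in> P \<times> Basis" for a
  proof -
    obtain R i where a: "a = (R, i)" "R \<in> P" using aP by auto
    have "x \<in> R \<longleftrightarrow> y \<in> R" if "Q \<in> P" "x \<in> Q" "y \<in> Q" for Q x y
      using that block_eqI a(2) by metis
    then show ?thesis
      using a unfolding a(1) case_prod_conv by (intro block_functionsI) (metis, metis UnionI)
  qed
  have \<phi>: "linear (?\<phi> a)" for a
    by (cases a) (auto intro!: linearI simp: inner_add_left scaleR_fun_def)
  have in_block: "x \<in> Q' \<longleftrightarrow> Q = Q'" if "Q \<in> P" "Q' \<in> P" "x \<in> Q" for Q Q' x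
    using that block_eqI by blast
  have dual: "?\<phi> a (?b a') = (if a = a' then 1 else 0)"
    if "a \<in> P \<times> Basis" "a' \<in> P \<times> Basis" for a a'
    using that in_block[OF _ _ rep_in] by (auto simp: inner_Basis split: if_splits)
  have expand: "u = (\<Sum>a\<in>P \<times> Basis. ?\<phi> a u *\<^sub>R ?b a)" if u: "u \<in> block_functions P" for u
  proof
    fix x
    have "(\<Sum>a\<in>P \<times> Basis. ?\<phi> a u *\<^sub>R ?b a) x =
        (\<Sum>Q\<in>P. \<Sum>i\<in>Basis. (u (rep Q) \<bullet> i) *\<^sub>R (if x \<in> Q then i else 0))"
      by (simp add: sum_fun_apply scaleR_fun_def sum.cartesian_product case_prod_unfold)
    also have "\<dots> = (\<Sum>Q\<in>P. if x \<in> Q then u x else 0)"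
      by (intro sum.cong refl) (auto simp: euclidean_representation value_at_rep[OF u])
    also have "\<dots> = u x"
    proof (cases "x \<in> \<Union>P")
      case True
      then obtain Q where Q: "Q \<in> P" "x \<in> Q" by auto
      have "(\<Sum>Q'\<in>P. if x \<in> Q' then u x else 0) = (\<Sum>Q'\<in>P. if Q = Q' then u x else 0)"
        using in_block[OF Q(1) _ Q(2)] by (intro sum.cong) auto
      then show ?thesis using finite_blocks Q(1) by simp
    next
      case False
      then show ?thesis using u by (auto simp: block_functions_def intro!: sum.neutral)
    qed
    finally show "u x = (\<Sum>a\<in>P \<times> Basis. ?\<phi> a u *\<^sub>R ?b a) x" by simp
  qed
  show ?fin
    by (rule finite_dim_dual_basis[OF subspace_block_functions I b \<phi> dual expand])
  assume S: "orthogonal_transformation S"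
  then have S0: "S 0 = 0" by (intro linear_0 orthogonal_transformation_linear)
  have "trace_on (block_functions P) (twisted_pullback S \<tau>) =
      (\<Sum>a\<in>P \<times> Basis. ?\<phi> a (twisted_pullback S \<tau> (?b a)))"
    using twisted_pullback_image[OF S] orthogonal_transformation_linear[OF S]
    by (intro trace_on_dual_basis[OF subspace_block_functions I b \<phi> dual expand]
        linear_twisted_pullback) auto
  also have "\<dots> = (\<Sum>Q\<in>P. \<Sum>i\<in>Basis. S (if \<tau> (rep Q) \<in> Q then i else 0) \<bullet> i)"
    by (simp add: twisted_pullback_def sum.cartesian_product case_prod_unfold)
  also have "\<dots> = (\<Sum>Q\<in>P. if \<tau> ` Q = Q then \<Sum>i\<in>Basis. S i \<bullet> i else 0)"
  proof (rule sum.cong[OF refl])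
    fix Q assume Q: "Q \<in> P"
    have "\<tau> (rep Q) \<in> Q \<longleftrightarrow> \<tau> ` Q = Q"
      using in_block[OF blocks[OF Q] Q] rep_in[OF Q] by blast
    then show "(\<Sum>i\<in>Basis. S (if \<tau> (rep Q) \<in> Q then i else 0) \<bullet> i) =
        (if \<tau> ` Q = Q then \<Sum>i\<in>Basis. S i \<bullet> i else 0)"
      by (simp add: S0)
  qed
  also have "\<dots> = real (card {Q \<in> P. \<tau> ` Q = Q}) * (\<Sum>i\<in>Basis. S i \<bullet> i)"
    using finite_blocks by (simp add: sum.If_cases Int_def)
  finally show "trace_on (block_functions P) (twisted_pullback S \<tau>) =
      real (card {Q \<in> P. \<tau> ` Q = Q}) * (\<Sum>i\<in>Basis. S i \<bullet> i)" .
qed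

end

lemma trace_on_UNIV:
  fixes S :: "'b::euclidean_space \<Rightarrow> 'b"
  assumes "linear S"
  shows "trace_on UNIV S = (\<Sum>i\<in>Basis. S i \<bullet> i)"
  using assms
  by (intro trace_on_dual_basis[where b = "\<lambda>i. i" and \<phi> = "\<lambda>i u. u \<bullet> i"])
    (auto simp: inner_Basis euclidean_representation inner_add_left intro!: linearI)

section \<open>Orbits of a normal subgroup\<close>

text \<open>
  An action of \<open>G\<close> on a whole type that leaves the subset \<open>X\<close> invariant; the orbits are those of the
  normal subgroup \<open>H\<close>. The edges are the case where \<open>X\<close> is a proper subset: symmetries act on all vertex
  sets, and \<open>X\<close> is the set of those that are edges.
\<close>

locale normal_action = normal +
  fixes act :: "'a \<Rightarrow> 'x \<Rightarrow> 'x" and X :: "'x set"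
  assumes act_one: "act \<one> x = x"
    and act_mult: "g \<in> carrier G \<Longrightarrow> h \<in> carrier G \<Longrightarrow> act (g \<otimes> h) x = act g (act h x)"
    and act_closed: "g \<in> carrier G \<Longrightarrow> x \<in> X \<Longrightarrow> act g x \<in> X"
begin

definition orbit_of :: "'x \<Rightarrow> 'x set"
  where "orbit_of x = {act h x | h. h \<in> H}"

lemma act_inv:
  assumes "g \<in> carrier G"
  shows "act g (act (inv g) x) = x" "act (inv g) (act g x) = x"
  unfolding act_mult[OF assms inv_closed[OF assms], symmetric]
    act_mult[OF inv_closed[OF assms] assms, symmetric] r_inv[OF assms] l_inv[OF assms]
  by (rule act_one)+

lemma self_mem_orbit_of: "x \<in> orbit_of x"
  unfolding orbit_of_def mem_Collect_eq by (intro exI[of _ \<one>] conjI act_one[symmetric]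
      subgroup.one_closed[OF subgroup_axioms])

lemma orbit_of_eq:
  assumes "y \<in> orbit_of x"
  shows "orbit_of y = orbit_of x"
proof -
  obtain h where h: "h \<in> H" "y = act h x" using assms unfolding orbit_of_def by auto
  have "act k y = act (k \<otimes> h) x" if "k \<in> H" for k
    using that h by (simp add: act_mult mem_carrier)
  moreover have "act k x = act (k \<otimes> inv h) y" if "k \<in> H" for k
    using that h by (simp add: act_mult mem_carrier act_inv)
  ultimately show ?thesis
    using h(1) unfolding orbit_of_def by blast
qed

lemma partition_on_orbits: "partition_on X (orbit_of ` X)"
proof (rule partition_onI)
  show "\<Union> (orbit_of ` X) = X"
    using act_closed self_mem_orbit_of mem_carrier unfolding orbit_of_def by fastforce
  show "disjnt Q Q'" if "Q \<in> orbit_of ` X" "Q' \<in> orbit_of ` X" "Q \<noteq> Q'" for Q Q'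
    using that orbit_of_eq unfolding disjnt_def by blast
qed (use self_mem_orbit_of in auto)

text \<open>
  Normality turns \<open>g h\<close> into a translate from the other side: \<open>g h x = (g h g\<inverse>) (g x)\<close>.
\<close>

lemma image_orbit_of:
  assumes g: "g \<in> carrier G"
  shows "act g ` orbit_of x = orbit_of (act g x)"
proof
  show "act g ` orbit_of x \<subseteq> orbit_of (act g x)"
  proof
    fix y assume "y \<in> act g ` orbit_of x"
    then obtain h where h: "h \<in> H" "y = act g (act h x)" unfolding orbit_of_def by auto
    then have "y = act (g \<otimes> h \<otimes> inv g) (act g x)"
      using g by (simp add: act_mult mem_carrier act_inv)
    then show "y \<in> orbit_of (act g x)"
      using inv_op_closed2[OF g h(1)] unfolding orbit_of_def by blast
  qed
  show "orbit_of (act g x) \<subseteq> act g ` orbit_of x"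
  proof
    fix y assume "y \<in> orbit_of (act g x)"
    then obtain h where h: "h \<in> H" "y = act h (act g x)" unfolding orbit_of_def by auto
    then have "y = act g (act (inv g \<otimes> h \<otimes> g) x)"
      using g by (simp add: act_mult mem_carrier act_inv)
    then show "y \<in> act g ` orbit_of x"
      using inv_op_closed1[OF g h(1)] unfolding orbit_of_def by blast
  qed
qed

lemma block_permutation_orbits:
  assumes "finite (orbit_of ` X)" "g \<in> carrier G"
  shows "block_permutation X (orbit_of ` X) (act g)"
proof (rule block_permutation.intro[OF assms(1) partition_on_orbits])
  show "bij (act g)"
    using act_inv[OF assms(2)] by (intro o_bij[of "act (inv g)"]) auto
  show "act g ` Q \<in> orbit_of ` X" if "Q \<in> orbit_of ` X" for Q
    using that act_closed[OF assms(2)] image_orbit_of[OF assms(2)] by auto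
qed

lemma block_functions_orbits:
  "block_functions (orbit_of ` X) =
    {u :: 'x \<Rightarrow> 'c::real_vector. (\<forall>h\<in>H. \<forall>x\<in>X. u (act h x) = u x) \<and> (\<forall>x. x \<notin> X \<longrightarrow> u x = 0)}"
proof -
  have un: "\<Union> (orbit_of ` X) = X" by (rule partition_onD1[OF partition_on_orbits, symmetric])
  have "(\<forall>Q\<in>orbit_of ` X. \<forall>x\<in>Q. \<forall>y\<in>Q. u x = u y) \<longleftrightarrow>
      (\<forall>h\<in>H. \<forall>x\<in>X. u (act h x) = u x)" for u :: "'x \<Rightarrow> 'c"
  proof safe
    fix h x assume eq: "\<forall>Q\<in>orbit_of ` X. \<forall>x\<in>Q. \<forall>y\<in>Q. u x = u y" and "h \<in> H" "x \<in> X"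
    then have "orbit_of x \<in> orbit_of ` X" "act h x \<in> orbit_of x"
      unfolding orbit_of_def by blast+
    then show "u (act h x) = u x"
      using eq self_mem_orbit_of[of x] by metis
  next
    fix x y z
    assume inv: "\<forall>h\<in>H. \<forall>x\<in>X. u (act h x) = u x" and "x \<in> X"
      and "y \<in> orbit_of x" "z \<in> orbit_of x"
    then obtain h k where "h \<in> H" "y = act h x" "k \<in> H" "z = act k x"
      unfolding orbit_of_def by blast
    then have "u y = u x" "u z = u x" using inv \<open>x \<in> X\<close> by simp_all
    then show "u y = u z" by simp
  qed
  then show ?thesis unfolding block_functions_def un by (simp only:)
qed

lemma block_functions_orbits_invariant:
  assumes u: "u \<in> block_functions (orbit_of ` X)" and h: "h \<in> H"
  shows "u (act h x) = u x"
proof (cases "x \<in> X")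
  case True
  then show ?thesis using u h unfolding block_functions_orbits by blast
next
  case False
  then have "act h x \<notin> X"
    using act_closed[of "inv h" "act h x"] act_inv(2)[of h x] h mem_carrier by auto
  then show ?thesis using False u unfolding block_functions_orbits by auto
qed

end

text \<open>
  A member of the coset \<open>H g\<close> can be written \<open>h g = g (g\<inverse> h g)\<close>, and the factor on the right is in \<open>H\<close> and
  acts trivially on \<open>U\<close>. So the members of the coset agree on \<open>U\<close>, where the induced representation takes
  the value of any of them.
\<close>

lemma (in normal) quotient_rep_coset:
  assumes u: "u \<in> U" and g: "g \<in> carrier G"
    and mult: "\<And>g h u. g \<in> carrier G \<Longrightarrow> h \<in> carrier G \<Longrightarrow> \<rho> (g \<otimes> h) u = \<rho> g (\<rho> h u)"
    and triv: "\<And>h u. h \<in> H \<Longrightarrow> u \<in> U \<Longrightarrow> \<rho> h u = u"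
  shows "quotient_rep \<rho> U (H #> g) u = \<rho> g u"
proof -
  have "restrict (\<rho> (h \<otimes> g)) U = restrict (\<rho> g) U" if h: "h \<in> H" for h
  proof (rule restrict_ext)
    fix u assume u: "u \<in> U"
    have k: "inv g \<otimes> h \<otimes> g \<in> H" by (rule inv_op_closed1[OF g h])
    have "h \<otimes> g = g \<otimes> (inv g \<otimes> h \<otimes> g)"
      using g h by (simp add: m_assoc[symmetric] mem_carrier)
    then have "\<rho> (h \<otimes> g) u = \<rho> (g \<otimes> (inv g \<otimes> h \<otimes> g)) u"
      by (rule arg_cong[where f = "\<lambda>k. \<rho> k u"])
    also have "\<dots> = \<rho> g u"
      unfolding mult[OF g mem_carrier[OF k]] triv[OF k u] ..
    finally show "\<rho> (h \<otimes> g) u = \<rho> g u" .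
  qed
  moreover have "H #> g = (\<lambda>h. h \<otimes> g) ` H"
    unfolding r_coset_def by (rule UNION_singleton_eq_range)
  ultimately have "(\<lambda>g. restrict (\<rho> g) U) ` (H #> g) = (\<lambda>_. restrict (\<rho> g) U) ` H"
    by (simp add: image_image cong: image_cong)
  also have "\<dots> = {restrict (\<rho> g) U}"
    by (rule image_constant[OF subgroup.one_closed[OF subgroup_axioms]])
  finally have "(\<lambda>g. restrict (\<rho> g) U) ` (H #> g) = {restrict (\<rho> g) U}" .
  then show ?thesis unfolding quotient_rep_def using u by simp
qed

section \<open>Periodic frameworks\<close>

locale periodic_framework =
  fixes E :: "'v set set" and p :: "'v \<Rightarrow> real ^ 'd" and \<T> :: "('v, 'd) sym set"
  assumes framework: "discrete_periodic_framework E p \<T>"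
    and normal: "\<T> \<lhd> sym_group E p"
begin

sublocale normal \<T> "sym_group E p" by (rule normal)

abbreviation "\<G> \<equiv> sym_group E p"

abbreviation "act_v \<equiv> (fst :: ('v, 'd) sym \<Rightarrow> 'v \<Rightarrow> 'v)"
abbreviation "act_e \<equiv> (\<lambda>g :: ('v, 'd) sym. (`) (fst g))"

lemma fst_mult: "fst (g \<otimes>\<^bsub>\<G>\<^esub> h) = fst g \<circ> fst h"
  and snd_mult: "snd (g \<otimes>\<^bsub>\<G>\<^esub> h) = snd g \<circ> snd h"
  and fst_one: "fst \<one>\<^bsub>\<G>\<^esub> = id"
  and snd_one: "snd \<one>\<^bsub>\<G>\<^esub> = id"
  by (simp_all add: sym_group_def case_prod_unfold)

lemma
  assumes "g \<in> carrier \<G>"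
  shows automorphism: "graph_automorphism E (fst g)"
    and isometry: "dist (snd g x) (snd g y) = dist x y"
    and placement: "p (fst g v) = snd g (p v)"
  using assms by (auto simp: sym_group_def)

lemma bij_fst: "g \<in> carrier \<G> \<Longrightarrow> bij (fst g)"
  using automorphism unfolding graph_automorphism_def by blast

lemma fst_inv:
  assumes "g \<in> carrier \<G>"
  shows "fst (inv\<^bsub>\<G>\<^esub> g) = inv_into UNIV (fst g)"
proof (rule Hilbert_Choice.inv_equality[symmetric])
  show "fst (inv\<^bsub>\<G>\<^esub> g) (fst g x) = x" "fst g (fst (inv\<^bsub>\<G>\<^esub> g) x) = x" for x
    using fst_mult[of "inv\<^bsub>\<G>\<^esub> g" g] fst_mult[of g "inv\<^bsub>\<G>\<^esub> g"] assms fst_one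
    by (simp_all add: fun_eq_iff)
qed

lemma vimage_fst: "g \<in> carrier \<G> \<Longrightarrow> vimage (fst g) = act_e (inv\<^bsub>\<G>\<^esub> g)"
  by (rule ext) (simp add: fst_inv bij_vimage_eq_inv_image bij_fst)

lemma orthogonal_rho_sp: "g \<in> carrier \<G> \<Longrightarrow> orthogonal_transformation (rho_sp g)"
  unfolding orthogonal_transformation_isometry rho_sp_def
  using isometry[of g] by (simp add: dist_norm)

lemma linear_rho_sp: "g \<in> carrier \<G> \<Longrightarrow> linear (rho_sp g)"
  by (intro orthogonal_transformation_linear orthogonal_rho_sp)

lemma rho_sp_diff: "g \<in> carrier \<G> \<Longrightarrow> rho_sp g (x - y) = snd g x - snd g y"
  using linear_diff[OF linear_rho_sp, of g x y] by (simp add: rho_sp_def)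

lemma rho_sp_mult:
  "g \<in> carrier \<G> \<Longrightarrow> rho_sp (g \<otimes>\<^bsub>\<G>\<^esub> h) x = rho_sp g (rho_sp h x)"
  unfolding rho_sp_def[of h] rho_sp_diff by (simp add: rho_sp_def snd_mult)

text \<open>
  Only the generators are known to be translations; linear parts are multiplicative, so triviality
  passes to the group they generate.
\<close>

lemma rho_sp_translation:
  assumes "t \<in> \<T>"
  shows "rho_sp t x = x"
proof -
  have "full_rank_translation_subgroup E p \<T>"
    using framework unfolding discrete_periodic_framework_def by blast
  then obtain g :: "'d \<Rightarrow> ('v, 'd) sym" and c
    where gc: "\<forall>i. g i \<in> carrier \<G> \<and> snd (g i) = (\<lambda>x. x + c i)"
      and \<T>: "\<T> = generate \<G> (range g)"
    unfolding full_rank_translation_subgroup_def by (elim exE conjE)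
  have g: "g i \<in> carrier \<G>" and c: "snd (g i) = (\<lambda>x. x + c i)" for i
    using gc by simp_all
  have sp: "rho_sp (g i) x = x" for i x unfolding rho_sp_def c by simp
  have "\<forall>x. rho_sp t x = x"
    using assms unfolding \<T>
  proof (induction rule: generate.induct)
    case one
    then show ?case by (simp add: rho_sp_def snd_one)
  next
    case (incl h)
    then show ?case using sp by auto
  next
    case (inv h)
    then obtain i where h: "h = g i" by auto
    have "rho_sp (inv\<^bsub>\<G>\<^esub> h) x = x" for x
    proof -
      have "rho_sp (inv\<^bsub>\<G>\<^esub> h) x = rho_sp (inv\<^bsub>\<G>\<^esub> h) (rho_sp h x)" by (simp add: h sp)
      also have "\<dots> = rho_sp (inv\<^bsub>\<G>\<^esub> h \<otimes>\<^bsub>\<G>\<^esub> h) x"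
        using g by (intro rho_sp_mult[symmetric]) (simp add: h)
      also have "\<dots> = x" using g by (simp add: h l_inv rho_sp_def snd_one)
      finally show ?thesis .
    qed
    then show ?case ..
  next
    case (eng h k)
    then have "h \<in> carrier \<G>" using \<T> mem_carrier by blast
    then show ?case using eng.IH by (simp add: rho_sp_mult)
  qed
  then show ?thesis by blast
qed

lemma edge_endpoints:
  assumes "e \<in> E"
  obtains v w where "e = {v, w}"
  using framework assms unfolding discrete_periodic_framework_def bar_joint_framework_def
  by (metis card_2_iff)

lemma act_e_closed: "g \<in> carrier \<G> \<Longrightarrow> e \<in> E \<Longrightarrow> act_e g e \<in> E"
  using automorphism[of g] edge_endpoints[of e] unfolding graph_automorphism_def
  by (metis image_empty image_insert)

sublocale v: normal_action \<T> "sym_group E p" act_v UNIV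
  by unfold_locales (simp_all add: fst_one fst_mult)

sublocale e: normal_action \<T> "sym_group E p" act_e E
  by unfold_locales (simp_all only: fst_one fst_mult image_comp image_id id_apply act_e_closed)

abbreviation "VO \<equiv> vertex_orbits E p \<T>"
abbreviation "EO \<equiv> edge_orbits E p \<T>"

lemma vertex_orbits_eq: "VO = v.orbit_of ` UNIV"
  unfolding vertex_orbits_def orbits_def orbit_def v.orbit_of_def by auto

lemma edge_orbits_eq: "EO = e.orbit_of ` E"
  unfolding edge_orbits_def orbits_def orbit_def e.orbit_of_def Setcompr_eq_image
  by (intro image_cong) auto

lemma finite_vertex_orbits: "finite VO"
  using framework unfolding discrete_periodic_framework_def by blast

text \<open>
  A translate of any edge contains the chosen representative of one of the finitely many vertex orbits,
  and each representative is contained in finitely many edges.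
\<close>

lemma finite_edge_orbits: "finite EO"
proof -
  let ?D = "\<Union>Q\<in>VO. {e \<in> E. (SOME v. v \<in> Q) \<in> e}"
  have "EO \<subseteq> e.orbit_of ` ?D"
  proof
    fix Q assume "Q \<in> EO"
    then obtain e where e: "e \<in> E" and Q: "Q = e.orbit_of e"
      unfolding edge_orbits_eq by auto
    obtain v w where vw: "e = {v, w}" using edge_endpoints[OF e] .
    let ?r = "SOME x. x \<in> v.orbit_of v"
    have "?r \<in> v.orbit_of v"
      using v.self_mem_orbit_of by (rule someI)
    then obtain t where t: "t \<in> \<T>" "?r = fst t v" unfolding v.orbit_of_def by auto
    have "act_e t e \<in> e.orbit_of e" using t(1) unfolding e.orbit_of_def by blast
    then have "Q = e.orbit_of (act_e t e)"
      unfolding Q by (rule e.orbit_of_eq[symmetric])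
    moreover have "act_e t e \<in> E" using act_e_closed[OF mem_carrier[OF t(1)] e] .
    moreover have "?r \<in> act_e t e" unfolding t(2) vw by simp
    moreover have "v.orbit_of v \<in> VO" unfolding vertex_orbits_eq by simp
    ultimately show "Q \<in> e.orbit_of ` ?D" by blast
  qed
  moreover have "finite ?D"
    using finite_vertex_orbits framework
    unfolding discrete_periodic_framework_def bar_joint_framework_def by blast
  ultimately show ?thesis by (meson finite_imageI finite_subset)
qed

lemma vertex_permutation:
  assumes "g \<in> carrier \<G>"
  shows "block_permutation UNIV VO (inv_into UNIV (fst g))"
  unfolding vertex_orbits_eq fst_inv[OF assms, symmetric]
  using finite_vertex_orbits unfolding vertex_orbits_eq
  by (rule v.block_permutation_orbits[OF _ inv_closed[OF assms]])

lemma edge_permutation: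
  assumes "g \<in> carrier \<G>"
  shows "block_permutation E EO (vimage (fst g))"
  unfolding edge_orbits_eq vimage_fst[OF assms]
  using finite_edge_orbits unfolding edge_orbits_eq
  by (rule e.block_permutation_orbits[OF _ inv_closed[OF assms]])

lemma Hv_eq: "Hv \<T> = block_functions VO"
  unfolding vertex_orbits_eq v.block_functions_orbits Hv_def
  by auto

lemma He_eq: "He E \<T> = block_functions EO"
  unfolding edge_orbits_eq e.block_functions_orbits He_def
  by auto

lemma inner_v_eq: "inner_v E p \<T> = block_inner VO"
  by (intro ext) (simp add: inner_v_def block_inner_def)

lemma inner_e_eq: "inner_e E p \<T> = block_inner EO"
  by (intro ext) (simp add: inner_e_def block_inner_def)

lemma rho_v_eq: "rho_v g = twisted_pullback (rho_sp g) (inv_into UNIV (fst g))"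
  by (intro ext) (simp add: rho_v_def twisted_pullback_def)

lemma rho_e_eq: "rho_e g = twisted_pullback (\<lambda>x. x) (vimage (fst g))"
  by (intro ext) (simp add: rho_e_def twisted_pullback_def)

lemma rho_v_mult:
  assumes "g \<in> carrier \<G>" "h \<in> carrier \<G>"
  shows "rho_v (g \<otimes>\<^bsub>\<G>\<^esub> h) u = rho_v g (rho_v h u)"
  using assms by (simp add: rho_v_def fst_mult rho_sp_mult o_inv_distrib bij_fst)

lemma rho_e_mult: "rho_e (g \<otimes>\<^bsub>\<G>\<^esub> h) w = rho_e g (rho_e h w)"
  by (simp add: rho_e_def fst_mult vimage_comp)

lemma rho_n_mult: "rho_n (g \<otimes>\<^bsub>\<G>\<^esub> h) f = rho_n g (rho_n h f)"
  by (simp add: rho_n_def fst_mult vimage_comp)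

lemma rho_v_translation:
  assumes "t \<in> \<T>" "u \<in> Hv \<T>"
  shows "rho_v t u = u"
proof
  fix v
  have t: "inv\<^bsub>\<G>\<^esub> t \<in> \<T>" using assms(1) by (rule m_inv_closed)
  show "rho_v t u v = u v"
    using assms(2) t unfolding Hv_def
    by (simp add: rho_v_def rho_sp_translation[OF assms(1)]
        fst_inv[OF mem_carrier[OF assms(1)], symmetric])
qed

text \<open>
  The action on edge vectors is by preimages of edges, that is by images under the inverse
  translation.
\<close>

lemma rho_e_translation:
  assumes "t \<in> \<T>" "w \<in> He E \<T>"
  shows "rho_e t w = w"
proof
  fix e
  have t: "inv\<^bsub>\<G>\<^esub> t \<in> \<T>" using assms(1) by (rule m_inv_closed)
  show "rho_e t w e = w e"
    unfolding rho_e_def vimage_fst[OF mem_carrier[OF assms(1)]]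
    using assms(2) t unfolding He_eq edge_orbits_eq
    by (rule e.block_functions_orbits_invariant)
qed

lemma vimage_vertex_orbit:
  assumes "g \<in> carrier \<G>"
  shows "fst g -` v.orbit_of v = v.orbit_of (fst (inv\<^bsub>\<G>\<^esub> g) v)"
  unfolding vimage_fst[OF assms]
  by (rule v.image_orbit_of[OF inv_closed[OF assms]])

text \<open>
  Functions on the set of vertex orbits are block functions for the partition into singletons.
  Thus the permutation representation falls under the same trace formula.
\<close>

lemma vertex_orbit_space_eq: "vertex_orbit_space E p \<T> = block_functions ((\<lambda>Q. {Q}) ` VO)"
  unfolding vertex_orbit_space_def block_functions_def by auto

lemma orbit_space_permutation:
  assumes g: "g \<in> carrier \<G>"
  shows "block_permutation VO ((\<lambda>Q. {Q}) ` VO) (vimage (fst g))"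
proof
  show "finite ((\<lambda>Q. {Q}) ` VO)" using finite_vertex_orbits by simp
  show "partition_on VO ((\<lambda>Q. {Q}) ` VO)"
    by (rule partition_onI) (auto simp: disjnt_def)
  show "bij (vimage (fst g))"
    using bij_fst[OF g]
    by (intro o_bij[of "image (fst g)"])
      (auto simp: fun_eq_iff bij_is_inj inj_vimage_image_eq bij_is_surj surj_image_vimage_eq)
  show "vimage (fst g) ` Q \<in> (\<lambda>Q. {Q}) ` VO" if "Q \<in> (\<lambda>Q. {Q}) ` VO" for Q
    using that vimage_vertex_orbit[OF g] unfolding vertex_orbits_eq by auto
qed

lemma rho_n_translation:
  assumes t: "t \<in> \<T>" and f: "f \<in> vertex_orbit_space E p \<T>"
  shows "rho_n t f = f"
proof
  fix Q
  interpret block_permutation VO "(\<lambda>Q. {Q}) ` VO" "vimage (fst t)"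
    by (rule orbit_space_permutation[OF mem_carrier[OF t]])
  show "rho_n t f Q = f Q"
  proof (cases "Q \<in> VO")
    case True
    then obtain v where v: "Q = v.orbit_of v" unfolding vertex_orbits_eq by auto
    have "fst (inv\<^bsub>\<G>\<^esub> t) v \<in> v.orbit_of v"
      using m_inv_closed[OF t] unfolding v.orbit_of_def by blast
    then have "v.orbit_of (fst (inv\<^bsub>\<G>\<^esub> t) v) = v.orbit_of v"
      by (rule v.orbit_of_eq)
    then show ?thesis unfolding rho_n_def v vimage_vertex_orbit[OF mem_carrier[OF t]] by simp
  next
    case False
    then have "fst t -` Q \<notin> VO" using mem_Union_blocks_iff[of Q] by simp
    then show ?thesis using False f unfolding rho_n_def vertex_orbit_space_def by simp
  qed
qed

lemma rigidity_map_edge: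
  assumes "{v, w} \<in> E"
  shows "rigidity_map E p u {v, w} = (p v - p w) \<bullet> (u v - u w)"
proof -
  have "(THE r. \<exists>v' w'. {v, w} = {v', w'} \<and> r = (p v' - p w') \<bullet> (u v' - u w')) =
      (p v - p w) \<bullet> (u v - u w)"
    by (rule the_equality) (auto simp: doubleton_eq_iff inner_diff_left inner_diff_right)
  then show ?thesis using assms unfolding rigidity_map_def by simp
qed

lemma rigidity_map_nonedge: "e \<notin> E \<Longrightarrow> rigidity_map E p u e = 0"
  by (simp add: rigidity_map_def)

lemma linear_rigidity_map: "linear (rigidity_map E p)"
proof (rule linearI; rule ext)
  fix u u' :: "'v \<Rightarrow> real ^ 'd" and c e
  show "rigidity_map E p (u + u') e = (rigidity_map E p u + rigidity_map E p u') e"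
  proof (cases "e \<in> E")
    case True
    then obtain v w where "e = {v, w}" by (rule edge_endpoints)
    then show ?thesis
      using True by (simp add: rigidity_map_edge inner_add_right inner_diff_right)
  qed (simp add: rigidity_map_nonedge)
  show "rigidity_map E p (c *\<^sub>R u) e = (c *\<^sub>R rigidity_map E p u) e"
  proof (cases "e \<in> E")
    case True
    then obtain v w where "e = {v, w}" by (rule edge_endpoints)
    then show ?thesis
      using True by (simp add: rigidity_map_edge scaleR_fun_def scaleR_diff_right[symmetric])
  qed (simp add: rigidity_map_nonedge scaleR_fun_def)
qed

text \<open>
  With \<open>\<tau>\<close> the inverse of the vertex permutation, both \<open>p v - p w\<close> and the difference of the values of
  \<open>rho_v g u\<close> at \<open>v\<close> and \<open>w\<close> are images under the linear part of \<open>g\<close> of the corresponding differences at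
  \<open>\<tau> v\<close> and \<open>\<tau> w\<close>, and the linear part is orthogonal.
\<close>

lemma rigidity_map_equivariant:
  assumes g: "g \<in> carrier \<G>"
  shows "rigidity_map E p (rho_v g u) = rho_e g (rigidity_map E p u)"
proof
  fix e
  let ?\<tau> = "fst (inv\<^bsub>\<G>\<^esub> g)"
  have \<tau>: "fst g (?\<tau> v) = v" "?\<tau> (fst g v) = v" for v
    using v.act_inv[OF g] by auto
  show "rigidity_map E p (rho_v g u) e = rho_e g (rigidity_map E p u) e"
  proof (cases "e \<in> E")
    case True
    obtain v w where e: "e = {v, w}" using edge_endpoints[OF True] .
    have \<tau>e: "{?\<tau> v, ?\<tau> w} \<in> E" using act_e_closed[OF inv_closed[OF g] True] unfolding e by simp
    have "p v - p w = rho_sp g (p (?\<tau> v) - p (?\<tau> w))"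
      using placement[OF g, of "?\<tau> v"] placement[OF g, of "?\<tau> w"] \<tau>
      by (simp add: rho_sp_diff[OF g])
    moreover have "rho_v g u v - rho_v g u w = rho_sp g (u (?\<tau> v) - u (?\<tau> w))"
      unfolding rho_v_def fst_inv[OF g, symmetric] by (simp add: linear_diff[OF linear_rho_sp[OF g]])
    ultimately have "rigidity_map E p (rho_v g u) e =
        (p (?\<tau> v) - p (?\<tau> w)) \<bullet> (u (?\<tau> v) - u (?\<tau> w))"
      using orthogonal_rho_sp[OF g] True unfolding e
      by (simp add: rigidity_map_edge orthogonal_transformation_def)
    then show ?thesis
      using \<tau>e unfolding rho_e_def vimage_fst[OF g] e by (simp add: rigidity_map_edge)
  next
    case False
    have "fst g -` e \<notin> E"
      using False act_e_closed[OF g, of "fst g -` e"] bij_is_surj[OF bij_fst[OF g]]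
      by (auto simp: surj_image_vimage_eq)
    then show ?thesis using False by (simp add: rho_e_def rigidity_map_nonedge)
  qed
qed

text \<open>
  A periodic \<open>u\<close> is fixed by translations, hence so is its image, by equivariance.
\<close>

lemma rigidity_map_Hv: "u \<in> Hv \<T> \<Longrightarrow> rigidity_map E p u \<in> He E \<T>"
proof -
  assume u: "u \<in> Hv \<T>"
  have "rigidity_map E p u (fst t ` e) = rigidity_map E p u e" if t: "t \<in> \<T>" for t e
  proof -
    have t': "inv\<^bsub>\<G>\<^esub> t \<in> \<T>" using t by (rule m_inv_closed)
    have "rigidity_map E p u e = rigidity_map E p (rho_v (inv\<^bsub>\<G>\<^esub> t) u) e"
      by (simp add: rho_v_translation[OF t' u])
    also have "\<dots> = rigidity_map E p u (fst t ` e)"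
      unfolding rigidity_map_equivariant[OF mem_carrier[OF t']] rho_e_def
        vimage_fst[OF mem_carrier[OF t']] inv_inv[OF mem_carrier[OF t]] ..
    finally show ?thesis by simp
  qed
  then show ?thesis unfolding He_def by (simp add: rigidity_map_nonedge)
qed

lemma subspace_H_rig: "subspace (H_rig :: ('v \<Rightarrow> real ^ 'd) set)"
  unfolding H_rig_def
  by (intro linear_subspace_image linearI) (simp_all add: scaleR_fun_def plus_fun_def)

lemma H_rig_flex:
  assumes "u \<in> H_rig"
  shows "u \<in> Hv \<T>" "rigidity_map E p u = 0"
proof -
  obtain c where u: "u = (\<lambda>v. c)" using assms unfolding H_rig_def by auto
  show "u \<in> Hv \<T>" unfolding u Hv_def by simp
  show "rigidity_map E p u = 0"
  proof
    fix e show "rigidity_map E p u e = 0 e"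
    proof (cases "e \<in> E")
      case True
      then obtain v w where "e = {v, w}" by (rule edge_endpoints)
      then show ?thesis using True by (simp add: u rigidity_map_edge)
    qed (simp add: rigidity_map_nonedge)
  qed
qed

lemma rho_v_H_rig:
  assumes g: "g \<in> carrier \<G>"
  shows "rho_v g ` H_rig = H_rig"
proof -
  have "rho_v g ` H_rig = (\<lambda>c v. c) ` range (rho_sp g)"
    unfolding H_rig_def image_image rho_v_def ..
  also have "\<dots> = H_rig"
    unfolding H_rig_def orthogonal_transformation_surj[OF orthogonal_rho_sp[OF g]] ..
  finally show ?thesis .
qed

text \<open>
  Fixed orbits appear as fixed singleton blocks, on functions with values in the one-dimensional
  space of real numbers.
\<close>

lemma Gamma_v_eq:
  assumes g: "g \<in> carrier \<G>"
  shows "Gamma_v E p \<T> (\<T> #>\<^bsub>\<G>\<^esub> g) = real (card {Q \<in> VO. fst g -` Q = Q})"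
proof -
  interpret n: block_permutation VO "(\<lambda>Q. {Q}) ` VO" "vimage (fst g)"
    by (rule orbit_space_permutation[OF g])
  have rho_n: "rho_n g = twisted_pullback (\<lambda>x. x) (vimage (fst g))"
    by (intro ext) (simp add: rho_n_def twisted_pullback_def)
  have "Gamma_v E p \<T> (\<T> #>\<^bsub>\<G>\<^esub> g) = trace_on (vertex_orbit_space E p \<T>) (rho_n g)"
    unfolding Gamma_v_def
    by (intro trace_on_cong quotient_rep_coset g rho_n_mult rho_n_translation)
      (auto simp: vertex_orbit_space_eq subspace_block_functions)
  also have "\<dots> = real (card {Q' \<in> (\<lambda>Q. {Q}) ` VO. vimage (fst g) ` Q' = Q'})"
    unfolding vertex_orbit_space_eq rho_n
    by (subst n.trace_twisted_pullback) (simp_all add: orthogonal_transformation_id)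
  also have "{Q' \<in> (\<lambda>Q. {Q}) ` VO. vimage (fst g) ` Q' = Q'} = (\<lambda>Q. {Q}) ` {Q \<in> VO. fst g -` Q = Q}"
    by auto
  also have "card \<dots> = card {Q \<in> VO. fst g -` Q = Q}"
    by (intro card_image inj_onI) simp
  finally show ?thesis .
qed

lemma Gamma_sp_eq:
  assumes g: "g \<in> carrier \<G>"
  shows "Gamma_sp (\<T> #>\<^bsub>\<G>\<^esub> g) = (\<Sum>i\<in>Basis. rho_sp g i \<bullet> i)"
proof -
  have "Gamma_sp (\<T> #>\<^bsub>\<G>\<^esub> g) = trace_on UNIV (rho_sp g)"
    unfolding Gamma_sp_def
    by (intro trace_on_cong quotient_rep_coset g rho_sp_mult rho_sp_translation) auto
  then show ?thesis using trace_on_UNIV[OF linear_rho_sp[OF g]] by simp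
qed

lemma trace_rho_v:
  assumes g: "g \<in> carrier \<G>"
  shows "trace_on (Hv \<T>) (rho_v g) = Gamma_v E p \<T> (\<T> #>\<^bsub>\<G>\<^esub> g) * Gamma_sp (\<T> #>\<^bsub>\<G>\<^esub> g)"
proof -
  interpret vp: block_permutation UNIV VO "inv_into UNIV (fst g)"
    by (rule vertex_permutation[OF g])
  show ?thesis
    unfolding Gamma_v_eq[OF g] Gamma_sp_eq[OF g] Hv_eq rho_v_eq
      vp.trace_twisted_pullback[OF orthogonal_rho_sp[OF g]] bij_vimage_eq_inv_image[OF bij_fst[OF g]] ..
qed

lemma quotient_rep_v:
  "g \<in> carrier \<G> \<Longrightarrow> u \<in> Hv \<T> \<Longrightarrow> quotient_rep rho_v (Hv \<T>) (\<T> #>\<^bsub>\<G>\<^esub> g) u = rho_v g u"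
  by (intro quotient_rep_coset rho_v_mult rho_v_translation)

lemma quotient_rep_e:
  "g \<in> carrier \<G> \<Longrightarrow> w \<in> He E \<T> \<Longrightarrow> quotient_rep rho_e (He E \<T>) (\<T> #>\<^bsub>\<G>\<^esub> g) w = rho_e g w"
  by (intro quotient_rep_coset rho_e_mult rho_e_translation)

lemma H_mech_eq:
  "H_mech E p \<T> = orth_compl (inner_v E p \<T>) {u \<in> Hv \<T>. rigidity_map E p u = 0} H_rig"
  unfolding H_mech_def orth_compl_def by auto

lemma H_str_eq: "H_str E p \<T> = orth_compl (inner_e E p \<T>) (He E \<T>) (rigidity_map E p ` Hv \<T>)"
  unfolding H_str_def orth_compl_def by auto

text \<open>
  The abstract index formula for \<open>R = rigidity_map E p\<close>, with \<open>K\<close> the space of translation flexes.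
  The representative \<open>g\<close> computes all six characters.
\<close>

theorem character_counting_formula:
  assumes g: "g \<in> carrier \<G>"
  defines "h \<equiv> \<T> #>\<^bsub>\<G>\<^esub> g"
  shows "Gamma_m E p \<T> h - Gamma_s E p \<T> h =
    Gamma_v E p \<T> h * Gamma_sp h - Gamma_e E \<T> h - Gamma_rig \<T> h"
proof -
  interpret vp: block_permutation UNIV VO "inv_into UNIV (fst g)"
    by (rule vertex_permutation[OF g])
  interpret ep: block_permutation E EO "vimage (fst g)"
    by (rule edge_permutation[OF g])
  note S = orthogonal_rho_sp[OF g]
  note id = orthogonal_transformation_id
  have ip_v: "anisotropic_form_on (Hv \<T>) (inner_v E p \<T>)"
    unfolding Hv_eq inner_v_eq by (rule vp.anisotropic_block_inner)
  have ip_e: "anisotropic_form_on (He E \<T>) (inner_e E p \<T>)"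
    unfolding He_eq inner_e_eq by (rule ep.anisotropic_block_inner)
  have sub_ker: "subspace {u \<in> Hv \<T>. rigidity_map E p u = 0}"
    unfolding Hv_eq Collect_conj_eq Collect_mem_eq
    by (intro subspace_inter subspace_block_functions linear_subspace_kernel linear_rigidity_map)
  have "trace_on (H_mech E p \<T>) (rho_v g) - trace_on (H_str E p \<T>) (rho_e g) =
      trace_on (Hv \<T>) (rho_v g) - trace_on (He E \<T>) (rho_e g) - trace_on H_rig (rho_v g)"
    unfolding H_mech_eq H_str_eq
  proof (rule trace_index_formula)
    show "finite_dim (Hv \<T>)" unfolding Hv_eq by (rule vp.finite_dim_block_functions)
    show "finite_dim (He E \<T>)" unfolding He_eq by (rule ep.finite_dim_block_functions)
    show "linear (rho_v g)"
      unfolding rho_v_eq by (intro linear_twisted_pullback linear_rho_sp g)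
    show "linear (rho_e g)"
      unfolding rho_e_eq by (intro linear_twisted_pullback linear_id[unfolded id_def])
    show "rho_v g ` Hv \<T> = Hv \<T>"
      unfolding rho_v_eq Hv_eq by (rule vp.twisted_pullback_image[OF S])
    show "rho_e g ` He E \<T> \<subseteq> He E \<T>"
      unfolding rho_e_eq He_eq by (rule equalityD1[OF ep.twisted_pullback_image[OF id]])
    show "inner_v E p \<T> (rho_v g u) (rho_v g u') = inner_v E p \<T> u u'"
      if "u \<in> Hv \<T>" "u' \<in> Hv \<T>" for u u'
      using that unfolding rho_v_eq Hv_eq inner_v_eq by (rule vp.block_inner_twisted_pullback[OF S])
    show "inner_e E p \<T> (rho_e g w) (rho_e g w') = inner_e E p \<T> w w'"
      if "w \<in> He E \<T>" "w' \<in> He E \<T>" for w w'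
      using that unfolding rho_e_eq He_eq inner_e_eq by (rule ep.block_inner_twisted_pullback[OF id])
  qed (use ip_v ip_e linear_rigidity_map rigidity_map_Hv rigidity_map_equivariant[OF g]
      subspace_H_rig H_rig_flex rho_v_H_rig[OF g] in auto)
  moreover have "Gamma_m E p \<T> h = trace_on (H_mech E p \<T>) (rho_v g)"
    unfolding Gamma_m_def h_def
  proof (rule trace_on_cong)
    show "subspace (H_mech E p \<T>)"
      unfolding H_mech_eq
      by (intro subspace_orth_compl sub_ker anisotropic_form_on_subset[OF ip_v]) auto
    show "quotient_rep rho_v (Hv \<T>) (\<T> #>\<^bsub>\<G>\<^esub> g) u = rho_v g u"
      if "u \<in> H_mech E p \<T>" for u
      using that by (intro quotient_rep_v g) (simp add: H_mech_def)
  qed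
  moreover have "Gamma_s E p \<T> h = trace_on (H_str E p \<T>) (rho_e g)"
    unfolding Gamma_s_def h_def
  proof (rule trace_on_cong)
    show "subspace (H_str E p \<T>)"
      unfolding H_str_eq using subspace_block_functions[of EO]
      by (intro subspace_orth_compl ip_e) (simp add: He_eq)
    show "quotient_rep rho_e (He E \<T>) (\<T> #>\<^bsub>\<G>\<^esub> g) w = rho_e g w"
      if "w \<in> H_str E p \<T>" for w
      using that by (intro quotient_rep_e g) (simp add: H_str_def)
  qed
  moreover have "Gamma_e E \<T> h = trace_on (He E \<T>) (rho_e g)"
    unfolding Gamma_e_def h_def
    by (intro trace_on_cong quotient_rep_e g) (simp_all add: He_eq subspace_block_functions)
  moreover have "Gamma_rig \<T> h = trace_on H_rig (rho_v g)"
    unfolding Gamma_rig_def h_def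
    by (intro trace_on_cong quotient_rep_v g subspace_H_rig H_rig_flex)
  ultimately show ?thesis using trace_rho_v[OF g] unfolding h_def by simp
qed

end

theorem theorem4p8:
  fixes E :: "'v set set"
    and p :: "'v \<Rightarrow> real ^ 'd"
    and \<T> :: "('v, 'd) sym set"
  assumes "discrete_periodic_framework E p \<T>"
    and "\<T> \<lhd> sym_group E p"
  shows "\<forall>h \<in> carrier (sym_group E p Mod \<T>).
    Gamma_m E p \<T> h - Gamma_s E p \<T> h =
      Gamma_v E p \<T> h * Gamma_sp h - Gamma_e E \<T> h - Gamma_rig \<T> h"
proof
  interpret periodic_framework E p \<T> using assms by (rule periodic_framework.intro)
  fix h assume "h \<in> carrier (sym_group E p Mod \<T>)"
  then obtain g where "g \<in> carrier (sym_group E p)" "h = \<T> #>\<^bsub>sym_group E p\<^esub> g"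
    unfolding FactGroup_def RCOSETS_def by auto
  then show "Gamma_m E p \<T> h - Gamma_s E p \<T> h =
      Gamma_v E p \<T> h * Gamma_sp h - Gamma_e E \<T> h - Gamma_rig \<T> h"
    using character_counting_formula by blast
qed

end
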